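(* Let $A\in Gl(d,\mathbb{R})$, $B\in\mathbb{R}^{d\times m}$, and let $U\subset\mathbb{R}^m$ be a compact convex neighborhood of the origin with $U=\overline{\mathrm{int}\,U}$. Consider the linear control system $x_{k+1}=Ax_k+Bu_k$, $u_k\in U$, $k\in\mathbb{N}_0$. Assume that the system without control restriction is controllable in $\mathbb{R}^d$ (i.e. $\mathrm{rank}[B\ AB\ \cdots\ A^{d-1}B]=d$) and that $A$ is hyperbolic (no eigenvalue of absolute value $1$). Let $D$ be the unique control set with nonvoid interior. Then $D$ is bounded, and for every compact set $K\subset D$ with nonvoid interior and every $f\in C(U,\mathbb{R})$ the invariance pressure is $$P_{inv}(f,K,D)=\log|\det A^+|+\min_{u\in U}f(u)=h_{inv}(K,D)+\min_{u\in U}f(u).$$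
   Context: $\mathbb{N}=\{1,2,\dots\}$, $\mathbb{N}_0=\{0,1,2,\dots\}$, $\mathcal{U}=U^{\mathbb{N}_0}$. For $x\in\mathbb{R}^d$, $u=(u_i)\in\mathcal{U}$ the solution is $\varphi(k,x,u)=A^kx+\sum_{i=0}^{k-1}A^{k-1-i}Bu_i$, $k\in\mathbb{N}_0$. The reachable set is $\mathbf{R}(x)=\{\varphi(k,x,u)\mid k\in\mathbb{N},u\in\mathcal{U}\}$. A nonvoid set $D\subset\mathbb{R}^d$ is a control set if it is maximal (with respect to inclusion) with the properties: (i) $D\subset\overline{\mathbf{R}(x)}$ for all $x\in D$; (ii) for every $x\in D$ there is $u\in\mathcal{U}$ with $\varphi(k,x,u)\in D$ for all $k\in\mathbb{N}$. Under the stated hypotheses there is exactly one control set with nonvoid interior. $A^+$ is the restriction of $A$ to the unstable subspace $E^u$, the direct sum of the generalized real eigenspaces of $A$ for eigenvalues with $|\lambda|>1$; thus $\log|\det A^+|=\sum_{\lambda\in\sigma(A)}n_\lambda\max\{0,\log|\lambda|\}$, where $n_\lambda$ is the algebraic multiplicity of $\lambda$. For $\tau\in\mathbb{N}$, a set $\mathcal{S}\subset\mathcal{U}$ is $(\tau,K,D)$-spanning if for all $x\in K$ there is $u\in\mathcal{S}$ with $\varphi(k,x,u)\in D$ for all $k\in\{1,\dots,\tau\}$. For $f\in C(U,\mathbb{R})$ (continuous real functions on $U$) put $(S_\tau f)(u)=\sum_{i=0}^{\tau-1}f(u_i)$, $a_\tau(f,K,D)=\inf\{\sum_{u\in\mathcal{S}}e^{(S_\tau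 f)(u)}\mid\mathcal{S}\ (\tau,K,D)\text{-spanning}\}$, and $P_{inv}(f,K,D)=\limsup_{\tau\to\infty}\frac1\tau\log a_\tau(f,K,D)$. The invariance entropy is $h_{inv}(K,D)=P_{inv}(\mathbf{0},K,D)$ with $\mathbf{0}$ the zero function. *)

theory Defs
  imports "HOL-Analysis.Analysis"
begin

section \<open>Linear algebra\<close>

(* On the type 'a^'n^'n the library operations * and ^ are componentwise,
   so powers with respect to ** need their own definition. *)
primrec mat_power :: "'a::semiring_1^'n^'n \<Rightarrow> nat \<Rightarrow> 'a^'n^'n" where
  "mat_power A 0 = mat 1"
| "mat_power A (Suc k) = A ** mat_power A k"

(* The block matrix [B  AB ... A^(d-1)B].  Column (p, j) is column j of A^k B, where k is the number
   of p in a fixed enumeration of 'd by 0, ..., d-1; the order of the columns does not affect the rank. *)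
definition kalman_matrix :: "real^'d^'d \<Rightarrow> real^'m^'d \<Rightarrow> real^('d \<times> 'm)^'d" where
  "kalman_matrix A B =
     (\<chi> i c. (mat_power A (to_nat_on (UNIV :: 'd set) (fst c)) ** B) $ i $ snd c)"

lemma columns_kalman_matrix:
  fixes A :: "real^'d^'d" and B :: "real^'m^'d"
  shows "columns (kalman_matrix A B) = (\<Union>k<CARD('d). columns (mat_power A k ** B))"
proof -
  have "bij_betw (to_nat_on (UNIV :: 'd set)) UNIV {..<CARD('d)}"
    by (rule to_nat_on_finite) simp
  then have eq: "{..<CARD('d)} = range (to_nat_on (UNIV :: 'd set))"
    by (simp add: bij_betw_def)
  have col: "column (p, j) (kalman_matrix A B) = column j (mat_power A (to_nat_on UNIV p) ** B)" for p j
    by (simp add: column_def kalman_matrix_def)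
  show ?thesis
    unfolding eq columns_def by (auto simp: col)
qed

abbreviation complex_matrix :: "real^'d^'d \<Rightarrow> complex^'d^'d" where
  "complex_matrix A \<equiv> map_matrix complex_of_real A"

definition is_eigenvalue :: "real^'d^'d \<Rightarrow> complex \<Rightarrow> bool" where
  "is_eigenvalue A \<mu> \<longleftrightarrow> (\<exists>v. v \<noteq> 0 \<and> complex_matrix A *v v = \<mu> *s v)"

definition hyperbolic_matrix :: "real^'d^'d \<Rightarrow> bool" where
  "hyperbolic_matrix A \<longleftrightarrow> (\<forall>\<mu>. is_eigenvalue A \<mu> \<longrightarrow> cmod \<mu> \<noteq> 1)"

definition gen_eigenspace :: "real^'d^'d \<Rightarrow> complex \<Rightarrow> (complex^'d) set" where
  "gen_eigenspace A \<mu> = {v. \<exists>k. mat_power (complex_matrix A - mat \<mu>) k *v v = 0}"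

(* The complex generalized eigenspace is closed under multiplication by the imaginary unit, so
   the imaginary parts of its elements are included, and the space for cnj \<mu> is the same. *)
definition real_gen_eigenspace :: "real^'d^'d \<Rightarrow> complex \<Rightarrow> (real^'d) set" where
  "real_gen_eigenspace A \<mu> = (\<lambda>v. \<chi> i. Re (v $ i)) ` gen_eigenspace A \<mu>"

definition unstable_subspace :: "real^'d^'d \<Rightarrow> (real^'d) set" where
  "unstable_subspace A =
     span (\<Union>\<mu>\<in>{\<mu>. is_eigenvalue A \<mu> \<and> cmod \<mu> > 1}. real_gen_eigenspace A \<mu>)"

(* Determinant of the endomorphism of an f-invariant subspace S induced by a linear map f: the
   Leibniz formula for its matrix in a basis of S.  The entry in row p b and column b is the
   coefficient of p b in f b.  The value is independent of the basis, and it is 1 for S = {0}. *)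
definition det_on :: "'a::euclidean_space set \<Rightarrow> ('a \<Rightarrow> 'a) \<Rightarrow> real" where
  "det_on S f =
     (let bs = (SOME bs. independent bs \<and> span bs = S)
      in \<Sum>p | p permutes bs. of_int (sign p) * (\<Prod>b\<in>bs. representation bs (f b) (p b)))"

definition det_unstable :: "real^'d^'d \<Rightarrow> real" where
  "det_unstable A = det_on (unstable_subspace A) (\<lambda>x. A *v x)"

section \<open>Control sets\<close>

definition control_seqs :: "'u set \<Rightarrow> (nat \<Rightarrow> 'u) set" where
  "control_seqs U = {u. \<forall>i. u i \<in> U}"

definition solution ::
  "real^'d^'d \<Rightarrow> real^'m^'d \<Rightarrow> nat \<Rightarrow> real^'d \<Rightarrow> (nat \<Rightarrow> real^'m) \<Rightarrow> real^'d" where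
  "solution A B k x u =
     mat_power A k *v x + (\<Sum>i<k. (mat_power A (k - 1 - i) ** B) *v u i)"

definition reachable_set ::
  "real^'d^'d \<Rightarrow> real^'m^'d \<Rightarrow> (real^'m) set \<Rightarrow> real^'d \<Rightarrow> (real^'d) set" where
  "reachable_set A B U x = {solution A B k x u | k u. k \<ge> 1 \<and> u \<in> control_seqs U}"

definition control_set_props ::
  "real^'d^'d \<Rightarrow> real^'m^'d \<Rightarrow> (real^'m) set \<Rightarrow> (real^'d) set \<Rightarrow> bool" where
  "control_set_props A B U D \<longleftrightarrow>
     (\<forall>x\<in>D. D \<subseteq> closure (reachable_set A B U x)) \<and>
     (\<forall>x\<in>D. \<exists>u\<in>control_seqs U. \<forall>k\<ge>1. solution A B k x u \<in> D)"

definition is_control_set ::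
  "real^'d^'d \<Rightarrow> real^'m^'d \<Rightarrow> (real^'m) set \<Rightarrow> (real^'d) set \<Rightarrow> bool" where
  "is_control_set A B U D \<longleftrightarrow>
     D \<noteq> {} \<and> control_set_props A B U D \<and>
     (\<forall>D'. D \<subseteq> D' \<and> control_set_props A B U D' \<longrightarrow> D' = D)"

section \<open>Invariance pressure\<close>

definition is_spanning ::
  "real^'d^'d \<Rightarrow> real^'m^'d \<Rightarrow> (real^'m) set \<Rightarrow> nat \<Rightarrow> (real^'d) set \<Rightarrow> (real^'d) set
    \<Rightarrow> (nat \<Rightarrow> real^'m) set \<Rightarrow> bool" where
  "is_spanning A B U \<tau> K D S \<longleftrightarrow>
     S \<subseteq> control_seqs U \<and> (\<forall>x\<in>K. \<exists>u\<in>S. \<forall>k\<in>{1..\<tau>}. solution A B k x u \<in> D)"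

definition birkhoff_sum :: "nat \<Rightarrow> ('u \<Rightarrow> real) \<Rightarrow> (nat \<Rightarrow> 'u) \<Rightarrow> real" where
  "birkhoff_sum \<tau> f u = (\<Sum>i<\<tau>. f (u i))"

(* Spanning sets may be infinite, hence the sums and their infimum are taken in [0, \<infinity>];
   the infimum of the empty set is \<infinity>. *)
definition pressure_sum ::
  "real^'d^'d \<Rightarrow> real^'m^'d \<Rightarrow> (real^'m) set \<Rightarrow> nat \<Rightarrow> (real^'m \<Rightarrow> real)
    \<Rightarrow> (real^'d) set \<Rightarrow> (real^'d) set \<Rightarrow> ennreal" where
  "pressure_sum A B U \<tau> f K D =
     (INF S\<in>{S. is_spanning A B U \<tau> K D S}. \<Sum>\<^sub>\<infinity>u\<in>S. ennreal (exp (birkhoff_sum \<tau> f u)))"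

definition ln_ennreal :: "ennreal \<Rightarrow> ereal" where
  "ln_ennreal a = (if a = 0 then - \<infinity> else if a = \<infinity> then \<infinity> else ereal (ln (enn2real a)))"

definition invariance_pressure ::
  "real^'d^'d \<Rightarrow> real^'m^'d \<Rightarrow> (real^'m) set \<Rightarrow> (real^'m \<Rightarrow> real)
    \<Rightarrow> (real^'d) set \<Rightarrow> (real^'d) set \<Rightarrow> ereal" where
  "invariance_pressure A B U f K D =
     limsup (\<lambda>\<tau>. ereal (1 / real \<tau>) * ln_ennreal (pressure_sum A B U \<tau> f K D))"

definition invariance_entropy ::
  "real^'d^'d \<Rightarrow> real^'m^'d \<Rightarrow> (real^'m) set \<Rightarrow> (real^'d) set \<Rightarrow> (real^'d) set \<Rightarrow> ereal" where
  "invariance_entropy A B U K D = invariance_pressure A B U (\<lambda>_. 0) K D"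

end

theory Submission
  imports Defs "HOL-Computational_Algebra.Fundamental_Theorem_Algebra"
begin

text \<open>
  Let \<open>Es\<close> and \<open>Eu\<close> be the stable and the unstable subspace of \<open>A\<close>, let \<open>R\<close> be the set of points
  reachable from \<open>0\<close>, and let \<open>C\<close> be the set of points controllable to \<open>0\<close>.  Both are open and convex;
  \<open>R\<close> contains \<open>Eu\<close> and \<open>C\<close> contains \<open>Es\<close>, so \<open>R\<close> is a cylinder over its stable projection
  and \<open>C\<close> a cylinder over its unstable projection, and these projections are bounded.  Points of
  \<open>interior D\<close> are recurrent, hence lie in both closures, and this forces \<open>D = closure R \<inter> C\<close>.

  Let \<open>T\<close> be \<open>A\<close> on \<open>Eu\<close> and the identity on \<open>Es\<close>, so that \<open>\<bar>det T\<bar>\<close> is the unstable determinant.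
  Lower bound: the initial values in \<open>K\<close> served by one control for time \<open>\<tau>\<close> lie in the preimage of a ball
  of fixed radius under the \<open>\<tau>\<close>-th power of \<open>T\<close>, so at least a multiple of \<open>\<bar>det T\<bar>\<close> to the power \<open>\<tau>\<close>
  many controls are needed.  Upper bound: every \<open>x\<close> in \<open>K\<close> can be steered within \<open>C\<close>, via \<open>0\<close>, to the
  equilibrium of a constant control close to a minimizer of \<open>f\<close> and be kept there.  The control
  works for all \<open>y\<close> in \<open>K\<close> such that the image of \<open>y - x\<close> under the \<open>\<tau>\<close>-th power of \<open>T\<close> is small, and \<open>K\<close> is covered by
  at most a multiple of \<open>\<bar>det T\<bar>\<close> to the power \<open>\<tau>\<close> many such neighbourhoods.
\<close>

section \<open>Families of linear maps and matrix powers\<close>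

text \<open>Pointwise convergence on a finite orthonormal basis of \<open>W\<close> is already
  uniform on the unit ball: the norm of \<open>f k\<close> on \<open>W\<close> is at most the sum of
  the norms of the basis images.\<close>

lemma linear_family_small_on_subspace:
  fixes f :: "nat \<Rightarrow> 'a::euclidean_space \<Rightarrow> 'b::real_normed_vector"
  assumes W: "subspace W" and lin: "\<And>k. linear (f k)"
    and lim: "\<And>x. x \<in> W \<Longrightarrow> (\<lambda>k. f k x) \<longlonglongrightarrow> 0" and "0 < e"
  shows "\<forall>\<^sub>F k in sequentially. \<forall>x\<in>W. norm (f k x) \<le> e * norm x"
proof -
  obtain Bs where Bs: "Bs \<subseteq> W" "pairwise orthogonal Bs" "\<And>x. x \<in> Bs \<Longrightarrow> norm x = 1"
      "independent Bs" "span Bs = W"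
    by (metis orthonormal_basis_subspace[OF W])
  then have fin: "finite Bs"
    using independent_imp_finite by blast
  have "(\<lambda>k. \<Sum>b\<in>Bs. norm (f k b)) \<longlonglongrightarrow> (\<Sum>b\<in>Bs. 0)"
    using Bs(1) lim by (intro tendsto_sum tendsto_norm_zero) blast
  then have "\<forall>\<^sub>F k in sequentially. (\<Sum>b\<in>Bs. norm (f k b)) < e"
    using \<open>0 < e\<close> by (intro order_tendstoD) auto
  then show ?thesis
  proof eventually_elim
    case (elim k)
    show ?case
    proof
      fix x assume "x \<in> W"
      then have "x = (\<Sum>b\<in>Bs. (x \<bullet> b) *\<^sub>R b)"
        using orthonormal_basis_expand[OF Bs(2,3) _ fin, of x] Bs(5) by simp
      then have "f k x = f k (\<Sum>b\<in>Bs. (x \<bullet> b) *\<^sub>R b)"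
        by metis
      also have "\<dots> = (\<Sum>b\<in>Bs. (x \<bullet> b) *\<^sub>R f k b)"
        using lin[of k] by (simp add: linear_sum linear_cmul)
      finally have "norm (f k x) \<le> (\<Sum>b\<in>Bs. \<bar>x \<bullet> b\<bar> * norm (f k b))"
        by (metis (no_types, lifting) norm_scaleR sum.cong norm_sum)
      also have "\<dots> \<le> (\<Sum>b\<in>Bs. norm x * norm (f k b))"
        using Bs(3) by (intro sum_mono mult_right_mono) (metis Cauchy_Schwarz_ineq2 mult.right_neutral, simp)
      also have "\<dots> = (\<Sum>b\<in>Bs. norm (f k b)) * norm x"
        by (simp add: sum_distrib_left mult.commute)
      also have "\<dots> \<le> e * norm x"
        using elim by (intro mult_right_mono) auto
      finally show "norm (f k x) \<le> e * norm x" .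
    qed
  qed
qed

text \<open>Some \<open>f N\<close> has operator norm at most 1/2, so the norm is at least halved
  every \<open>N\<close> steps. Hence a partial sum is bounded by its first \<open>N\<close> terms
  plus half of itself.\<close>

lemma summable_onorm_semigroup:
  fixes f :: "nat \<Rightarrow> 'a::euclidean_space \<Rightarrow> 'a"
  assumes lin: "\<And>k. linear (f k)" and lim: "\<And>x. (\<lambda>k. f k x) \<longlonglongrightarrow> 0"
    and sg: "\<And>m n x. f (m + n) x = f m (f n x)"
  shows "summable (\<lambda>k. onorm (f k))"
proof -
  have bl: "bounded_linear (f k)" for k
    using lin linear_conv_bounded_linear by blast
  have "\<forall>\<^sub>F k in sequentially. \<forall>x\<in>UNIV. norm (f k x) \<le> (1/2) * norm x"
    using lin lim by (intro linear_family_small_on_subspace) auto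
  then obtain N where N: "\<And>x. norm (f N x) \<le> (1/2) * norm x"
    by (auto simp: eventually_sequentially)
  have step: "onorm (f (N + k)) \<le> (1/2) * onorm (f k)" for k
  proof (rule onorm_bound)
    show "0 \<le> 1/2 * onorm (f k)" using onorm_pos_le[OF bl] by simp
    fix x
    have "norm (f (N + k) x) \<le> (1/2) * norm (f k x)" using N sg by metis
    also have "\<dots> \<le> (1/2) * onorm (f k) * norm x" using onorm[OF bl, of k x] by simp
    finally show "norm (f (N + k) x) \<le> 1/2 * onorm (f k) * norm x" .
  qed
  have "(\<Sum>k<n. onorm (f k)) \<le> 2 * (\<Sum>k<N. onorm (f k))" for n
  proof -
    have "(\<Sum>k<n. onorm (f k)) \<le> (\<Sum>k<N+n. onorm (f k))"
      using onorm_pos_le[OF bl] by (intro sum_mono2) auto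
    also have "\<dots> = (\<Sum>k<N. onorm (f k)) + (\<Sum>k<n. onorm (f (N + k)))"
      by (simp add: lessThan_atLeast0 sum.atLeastLessThan_concat[symmetric, of 0 N "N+n"]
          sum.shift_bounds_nat_ivl[of _ 0 N n, simplified add_0 add.commute[of n]] add.commute)
    also have "(\<Sum>k<n. onorm (f (N + k))) \<le> (\<Sum>k<n. (1/2) * onorm (f k))"
      by (intro sum_mono step)
    also have "\<dots> = (1/2) * (\<Sum>k<n. onorm (f k))" by (simp add: sum_distrib_left)
    finally show ?thesis by simp
  qed
  then show ?thesis
    using onorm_pos_le[OF bl] by (intro summableI_nonneg_bounded) auto
qed

text \<open>\<open>x + e\<close> is the convex combination of \<open>x / (1 - t)\<close> and
  \<open>e / t\<close> with weights \<open>1 - t\<close> and \<open>t\<close>. For small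
  \<open>t > 0\<close> the former lies in \<open>Q\<close> by openness; the latter lies in
  \<open>E\<close>.\<close>

lemma open_convex_plus_subspace:
  fixes Q :: "'a::real_normed_vector set"
  assumes "open Q" "convex Q" "subspace E" "E \<subseteq> Q" "x \<in> Q" "e \<in> E"
  shows "x + e \<in> Q"
proof -
  have "((\<lambda>t. x /\<^sub>R (1 - t)) \<longlongrightarrow> x /\<^sub>R (1 - 0)) (at_right (0::real))"
    by (intro tendsto_intros) auto
  then have "\<forall>\<^sub>F t in at_right (0::real). x /\<^sub>R (1 - t) \<in> Q"
    using assms(1,5) by (intro topological_tendstoD) auto
  moreover have "\<forall>\<^sub>F t in at_right (0::real). 0 < t \<and> t < 1"
    using eventually_at_right_real[of 0 1] by (auto elim: eventually_mono)
  ultimately have "\<forall>\<^sub>F t in at_right (0::real). x /\<^sub>R (1 - t) \<in> Q \<and> 0 < t \<and> t < 1"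
    by eventually_elim auto
  then obtain t :: real where t: "x /\<^sub>R (1 - t) \<in> Q" "0 < t" "t < 1"
    using eventually_happens' trivial_limit_at_right_real by blast
  have "e /\<^sub>R t \<in> Q"
    using assms subspace_scale by blast
  then have "(1 - t) *\<^sub>R (x /\<^sub>R (1 - t)) + t *\<^sub>R (e /\<^sub>R t) \<in> Q"
    using t by (intro convexD[OF assms(2)]) auto
  then show ?thesis using t by simp
qed

lemma mat_power_add: "mat_power A (m + n) = mat_power A m ** mat_power A n"
  by (induction m) (auto simp: matrix_mul_assoc)

lemma mat_power_Suc_vec: "mat_power A (Suc k) *v x = A *v (mat_power A k *v x)"
  by (simp add: matrix_vector_mul_assoc)

lemma mat_power_add_vec: "mat_power A (m + n) *v x = mat_power A m *v (mat_power A n *v x)"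
  by (simp add: matrix_vector_mul_assoc mat_power_add)

lemma mat_power_Suc_vec': "mat_power A (Suc k) *v x = mat_power A k *v (A *v x)"
  using mat_power_add_vec[of A k 1 x] by simp

lemma mat_power_left_inverse_vec:
  fixes A :: "'a::comm_ring_1^'d^'d"
  assumes "A' ** A = mat 1"
  shows "mat_power A' k *v (mat_power A k *v x) = x"
proof (induction k)
  case (Suc k)
  have "mat_power A' (Suc k) *v (mat_power A (Suc k) *v x)
      = mat_power A' k *v ((A' ** A) *v (mat_power A k *v x))"
    by (metis matrix_vector_mul_assoc mat_power_Suc_vec mat_power_Suc_vec')
  then show ?case using Suc assms by simp
qed simp

lemma mat_power_inverse_cancel:
  fixes A :: "'a::comm_ring_1^'d^'d"
  assumes "A' ** A = mat 1" "k \<le> n"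
  shows "mat_power A' k *v (mat_power A n *v x) = mat_power A (n - k) *v x"
  using mat_power_left_inverse_vec[OF assms(1), of k "mat_power A (n - k) *v x"] assms(2)
  by (metis le_add_diff_inverse mat_power_add_vec)

section \<open>Generalized eigenspaces\<close>

lemma diff_mat_vec: "((M::'a::comm_ring_1^'d^'d) - mat c) *v w = M *v w - c *s w"
proof -
  have "mat c *v w = c *s w"
    by (simp add: vec_eq_iff matrix_vector_mult_def mat_def if_distrib if_distribR sum.delta cong: if_cong)
  then show ?thesis by (simp add: matrix_vector_mult_diff_rdistrib)
qed

lemma gen_eigenspace_subspace: "vec.subspace (gen_eigenspace A \<mu>)"
  unfolding vec.subspace_def
proof (intro conjI allI ballI)
  show "0 \<in> gen_eigenspace A \<mu>" by (auto simp: gen_eigenspace_def)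
  fix x y assume "x \<in> gen_eigenspace A \<mu>" "y \<in> gen_eigenspace A \<mu>"
  then obtain k l where "mat_power (complex_matrix A - mat \<mu>) k *v x = 0"
      "mat_power (complex_matrix A - mat \<mu>) l *v y = 0"
    by (auto simp: gen_eigenspace_def)
  then have "mat_power (complex_matrix A - mat \<mu>) (l + k) *v x = 0"
      "mat_power (complex_matrix A - mat \<mu>) (k + l) *v y = 0"
    by (simp_all add: mat_power_add_vec)
  then have "mat_power (complex_matrix A - mat \<mu>) (l + k) *v (x + y) = 0"
    by (simp add: matrix_vector_right_distrib add.commute)
  then show "x + y \<in> gen_eigenspace A \<mu>" by (auto simp: gen_eigenspace_def)
next
  fix c x assume "x \<in> gen_eigenspace A \<mu>"
  then show "c *s x \<in> gen_eigenspace A \<mu>"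
    by (auto simp: gen_eigenspace_def vector_scalar_commute)
qed

text \<open>Induction on an exponent annihilating \<open>v\<close>: applying
  \<open>A - \<mu>\<close> lowers it by one. Jordan chains are traversed this way below.\<close>

lemma gen_eigenspace_nilpotent_induct [consumes 1, case_names zero step]:
  assumes "v \<in> gen_eigenspace A \<mu>" and "P 0"
    and "\<And>v. P ((complex_matrix A - mat \<mu>) *v v) \<Longrightarrow> v \<in> gen_eigenspace A \<mu> \<Longrightarrow> P v"
  shows "P v"
proof -
  obtain k where "mat_power (complex_matrix A - mat \<mu>) k *v v = 0"
    using assms(1) by (auto simp: gen_eigenspace_def)
  then show ?thesis
  proof (induction k arbitrary: v)
    case (Suc k)
    show ?case
      by (rule assms(3), rule Suc.IH)
        (use Suc.prems in \<open>simp_all only: mat_power_Suc_vec'[symmetric] gen_eigenspace_def mem_Collect_eq\<close>, blast)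
  qed (use assms(2) in simp)
qed

lemma gen_eigenspace_preimage:
  assumes "(complex_matrix A - mat \<mu>) *v v \<in> gen_eigenspace A \<mu>"
  shows "v \<in> gen_eigenspace A \<mu>"
proof -
  obtain k where "mat_power (complex_matrix A - mat \<mu>) k *v ((complex_matrix A - mat \<mu>) *v v) = 0"
    using assms by (auto simp: gen_eigenspace_def)
  then have "mat_power (complex_matrix A - mat \<mu>) (Suc k) *v v = 0"
    by (simp only: mat_power_Suc_vec')
  then show ?thesis unfolding gen_eigenspace_def by blast
qed

text \<open>The last nonzero vector in the chain \<open>v\<close>, \<open>(A - \<mu>) v\<close>, ...
  is an eigenvector.\<close>

lemma gen_eigenspace_eigenvalue:
  assumes "v \<in> gen_eigenspace A \<mu>" "v \<noteq> 0"
  shows "is_eigenvalue A \<mu>"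
proof -
  have "v = 0 \<or> is_eigenvalue A \<mu>" using assms(1)
  proof (induction rule: gen_eigenspace_nilpotent_induct)
    case (step v)
    then show ?case by (auto simp: diff_mat_vec is_eigenvalue_def)
  qed simp
  then show ?thesis using assms(2) by simp
qed

text \<open>On the generalized eigenspace of \<nu>, \<open>A - \<mu>\<close> is a nilpotent map plus
  the nonzero scalar \<open>\<nu> - \<mu>\<close>, hence onto. If \<open>h\<close> solves the
  equation for \<open>(A - \<nu>) g\<close>, then \<open>(g - h) / (\<nu> - \<mu>)\<close> solves it
  for \<open>g\<close>.\<close>

lemma gen_eigenspace_image_shift:
  assumes "g \<in> gen_eigenspace A \<nu>" "\<mu> \<noteq> \<nu>"
  shows "\<exists>h \<in> gen_eigenspace A \<nu>. (complex_matrix A - mat \<mu>) *v h = g"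
  using assms(1)
proof (induction rule: gen_eigenspace_nilpotent_induct)
  case zero
  show ?case using vec.subspace_0[OF gen_eigenspace_subspace] by (intro bexI[of _ 0]) auto
next
  case (step g)
  then obtain h where h: "h \<in> gen_eigenspace A \<nu>"
      "(complex_matrix A - mat \<mu>) *v h = (complex_matrix A - mat \<nu>) *v g" by blast
  have "(complex_matrix A - mat \<mu>) *v (inverse (\<nu> - \<mu>) *s (g - h))
      = inverse (\<nu> - \<mu>) *s ((complex_matrix A - mat \<mu>) *v g - (complex_matrix A - mat \<nu>) *v g)"
    by (simp add: vector_scalar_commute matrix_vector_mult_diff_distrib h(2))
  also have "\<dots> = inverse (\<nu> - \<mu>) *s ((\<nu> - \<mu>) *s g)"
    by (simp add: diff_mat_vec vec.scale_left_diff_distrib)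
  also have "\<dots> = g" using assms(2)
    by (simp only: vector_smult_assoc) (simp add: assms(2)[symmetric])
  finally show ?case
    using h(1) step(2) gen_eigenspace_subspace
    by (intro bexI[of _ "inverse (\<nu> - \<mu>) *s (g - h)"])
      (auto intro: vec.subspace_scale vec.subspace_diff)
qed

abbreviation gen_eigenspan :: "real^'d^'d \<Rightarrow> (complex^'d) set" where
  "gen_eigenspan A \<equiv> vec.span (\<Union>\<nu>. gen_eigenspace A \<nu>)"

text \<open>Components belonging to \<nu> \<noteq> \<mu> are images under \<open>A - \<mu>\<close>
  of vectors of the same kind. Subtracting such images from a vector of the span leaves a component
  for \<mu>, and any preimage of that is again a generalized eigenvector.\<close>

lemma gen_eigenspan_preimage:
  assumes "(complex_matrix A - mat \<mu>) *v v \<in> gen_eigenspan A"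
  shows "v \<in> gen_eigenspan A"
proof -
  have "\<exists>h\<in>gen_eigenspan A. w - (complex_matrix A - mat \<mu>) *v h \<in> gen_eigenspace A \<mu>"
    if "w \<in> gen_eigenspan A" for w
    using that
  proof (induction rule: vec.span_induct_alt)
    case base
    show ?case using vec.subspace_0[OF gen_eigenspace_subspace]
      by (intro bexI[of _ 0]) (auto simp: vec.span_zero)
  next
    case (step c x y)
    then obtain h \<nu> where h: "h \<in> gen_eigenspan A"
        "y - (complex_matrix A - mat \<mu>) *v h \<in> gen_eigenspace A \<mu>" and \<nu>: "x \<in> gen_eigenspace A \<nu>"
      by blast
    show ?case
    proof (cases "\<mu> = \<nu>")
      case True
      have "c *s x + (y - (complex_matrix A - mat \<mu>) *v h) \<in> gen_eigenspace A \<mu>"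
        using h \<nu> True gen_eigenspace_subspace vec.subspace_add vec.subspace_scale by blast
      then show ?thesis using h(1) by (auto simp: algebra_simps)
    next
      case False
      then obtain g where g: "g \<in> gen_eigenspace A \<nu>" "(complex_matrix A - mat \<mu>) *v g = x"
        using gen_eigenspace_image_shift[OF \<nu>] by blast
      have "c *s g + h \<in> gen_eigenspan A"
        using g h by (intro vec.span_add vec.span_scale) (auto intro: vec.span_base)
      moreover have "c *s x + y - (complex_matrix A - mat \<mu>) *v (c *s g + h)
          = y - (complex_matrix A - mat \<mu>) *v h"
        by (simp add: matrix_vector_right_distrib vector_scalar_commute g(2))
      ultimately show ?thesis using h(2) by metis
    qed
  qed
  then obtain h where h: "h \<in> gen_eigenspan A"
      "(complex_matrix A - mat \<mu>) *v (v - h) \<in> gen_eigenspace A \<mu>"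
    using assms by (auto simp: matrix_vector_mult_diff_distrib)
  then have "v - h \<in> gen_eigenspan A"
    using gen_eigenspace_preimage by (blast intro: vec.span_base)
  then show ?thesis using h(1) vec.span_add by fastforce
qed

section \<open>Polynomials in a matrix; the generalized eigenvectors span the complex space\<close>

definition poly_act :: "complex poly \<Rightarrow> complex^'d^'d \<Rightarrow> complex^'d \<Rightarrow> complex^'d" where
  "poly_act p M v = (\<Sum>i\<le>degree p. coeff p i *s (mat_power M i *v v))"

lemma poly_act_le:
  assumes "degree p \<le> n"
  shows "poly_act p M v = (\<Sum>i\<le>n. coeff p i *s (mat_power M i *v v))"
  unfolding poly_act_def using assms
  by (intro sum.mono_neutral_left) (auto simp: coeff_eq_0)

lemma matrix_vector_mult_sum:
  "(M::'a::comm_ring_1^'n^'m) *v (\<Sum>i\<in>I. f i) = (\<Sum>i\<in>I. M *v f i)"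
  by (induction I rule: infinite_finite_induct) (simp_all add: matrix_vector_right_distrib)

lemma poly_act_linear_factor:
  "poly_act ([:- \<mu>, 1:] * q) M v = (M - mat \<mu>) *v poly_act q M v"
proof -
  let ?n = "degree q" and ?w = "\<lambda>i. mat_power M i *v v"
  \<comment> \<open>With \<open>q0\<close> the sums for \<open>q\<close> may also run up to
    \<open>Suc ?n\<close>, the top index occurring in the product.\<close>
  have q0: "coeff q (Suc ?n) = 0" by (simp add: coeff_eq_0)
  have "degree ([:- \<mu>, 1:] * q) \<le> Suc ?n"
    using degree_mult_le[of "[:- \<mu>, 1:]" q] by simp
  then have "poly_act ([:- \<mu>, 1:] * q) M v = (\<Sum>i\<le>Suc ?n. coeff ([:- \<mu>, 1:] * q) i *s ?w i)"
    by (rule poly_act_le)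
  also have "\<dots> = (\<Sum>i\<le>Suc ?n. coeff (pCons 0 q) i *s ?w i) - (\<Sum>i\<le>Suc ?n. \<mu> *s (coeff q i *s ?w i))"
    unfolding sum_subtractf[symmetric]
  proof (rule sum.cong)
    fix i
    have "coeff ([:- \<mu>, 1:] * q) i = coeff (pCons 0 q) i - \<mu> * coeff q i" by simp
    then show "coeff ([:- \<mu>, 1:] * q) i *s ?w i = coeff (pCons 0 q) i *s ?w i - \<mu> *s (coeff q i *s ?w i)"
      by (simp only: vec.scale_left_diff_distrib vector_smult_assoc)
  qed simp
  also have "(\<Sum>i\<le>Suc ?n. coeff (pCons 0 q) i *s ?w i) = (\<Sum>i\<le>?n. coeff q i *s ?w (Suc i))"
    by (subst sum.atMost_Suc_shift) simp
  also have "\<dots> = M *v poly_act q M v"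
    by (simp add: poly_act_def matrix_vector_mult_sum mat_power_Suc_vec vector_scalar_commute del: mat_power.simps)
  also have "(\<Sum>i\<le>Suc ?n. \<mu> *s (coeff q i *s ?w i)) = \<mu> *s poly_act q M v"
    by (simp add: poly_act_def q0 vec.scale_sum_right)
  finally show ?thesis by (simp add: diff_mat_vec)
qed

text \<open>Linear factors of \<open>p\<close>, which exist by the fundamental theorem of algebra,
  are removed one at a time by \<open>gen_eigenspan_preimage\<close>, until a nonzero constant
  remains.\<close>

lemma poly_act_in_gen_eigenspan:
  assumes "p \<noteq> 0" "poly_act p (complex_matrix A) v \<in> gen_eigenspan A"
  shows "v \<in> gen_eigenspan A"
  using assms
proof (induction "degree p" arbitrary: p)
  case 0
  then obtain c where c: "p = [:c:]" "c \<noteq> 0"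
    by (metis degree_eq_zeroE pCons_0_0)
  with 0 have "c *s v \<in> gen_eigenspan A" by (simp add: poly_act_def)
  then have "inverse c *s (c *s v) \<in> gen_eigenspan A" by (rule vec.span_scale)
  then show ?case using c by simp
next
  case (Suc n)
  then have "\<not> constant (poly p)" by (simp add: constant_degree)
  then obtain \<mu> where "poly p \<mu> = 0" using fundamental_theorem_of_algebra by blast
  then obtain q where q: "p = [:- \<mu>, 1:] * q" by (auto simp: poly_eq_0_iff_dvd)
  then have "q \<noteq> 0" using Suc.prems by auto
  then have "degree p = Suc (degree q)" unfolding q by (subst degree_mult_eq) auto
  moreover have "poly_act q (complex_matrix A) v \<in> gen_eigenspan A"
    using Suc.prems(2) gen_eigenspan_preimage unfolding q poly_act_linear_factor by blast
  ultimately show ?case using Suc.hyps \<open>q \<noteq> 0\<close> by (metis Suc_inject)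
qed

text \<open>The vectors \<open>v\<close>, \<open>M v\<close>, ... up to exponent
  \<open>CARD('d)\<close> are one more than the dimension, hence satisfy a nontrivial linear
  relation. Its coefficients are those of \<open>p\<close>.\<close>

lemma annihilating_polynomial:
  fixes M :: "complex^'d^'d"
  shows "\<exists>p. p \<noteq> 0 \<and> poly_act p M v = 0"
proof -
  let ?w = "\<lambda>i. mat_power M i *v v" and ?n = "CARD('d)"
  have "\<exists>c. (\<exists>i\<le>?n. c i \<noteq> 0) \<and> (\<Sum>i\<le>?n. c i *s ?w i) = 0"
  \<comment> \<open>Dependence is a property of a set of vectors. A repetition
    \<open>?w i = ?w j\<close> would shrink this set, but it is itself a relation.\<close>
  proof (cases "inj_on ?w {..?n}")
    case False
    then obtain i j where ij: "i \<le> ?n" "j \<le> ?n" "?w i = ?w j" "i \<noteq> j"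
      by (auto simp: inj_on_def)
    let ?c = "\<lambda>k. if k = i then 1::complex else if k = j then -1 else 0"
    have "(\<Sum>k\<le>?n. ?c k *s ?w k) = (\<Sum>k\<in>{i,j}. ?c k *s ?w k)"
      using ij by (intro sum.mono_neutral_right) auto
    also have "\<dots> = 0" using ij by simp
    finally have "(\<Sum>k\<le>?n. ?c k *s ?w k) = 0" .
    moreover have "\<exists>k\<le>?n. ?c k \<noteq> 0" using ij(1) by (intro exI[of _ i]) simp
    ultimately show ?thesis by (intro exI[of _ ?c] conjI)
  next
    case True
    have "vec.dependent (?w ` {..?n})"
    proof (rule ccontr)
      assume "\<not> vec.dependent (?w ` {..?n})"
      then have "card (?w ` {..?n}) \<le> vec.dim (UNIV :: (complex^'d) set)"
        by (intro vec.independent_card_le_dim) auto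
      then show False using True by (simp add: card_image vec.dim_UNIV card_cart_basis)
    qed
    then obtain u x where u: "x \<in> ?w ` {..?n}" "u x \<noteq> 0" "(\<Sum>x\<in>?w ` {..?n}. u x *s x) = 0"
      by (subst (asm) vec.dependent_finite) auto
    then have "(\<Sum>i\<le>?n. u (?w i) *s ?w i) = 0" by (simp add: sum.reindex[OF True])
    then show ?thesis using u(1,2) by (intro exI[of _ "\<lambda>i. u (?w i)"]) auto
  qed
  then obtain c where c: "\<exists>i\<le>?n. c i \<noteq> 0" "(\<Sum>i\<le>?n. c i *s ?w i) = 0" by blast
  define p where "p = (\<Sum>i\<le>?n. monom (c i) i)"
  have cf: "coeff p i = (if i \<le> ?n then c i else 0)" for i
    by (simp add: p_def coeff_sum if_distrib sum.delta cong: if_cong)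
  then have "p \<noteq> 0" using c(1) by (metis coeff_0)
  moreover have "degree p \<le> ?n" using cf by (intro degree_le) auto
  then have "poly_act p M v = 0" using c(2) by (simp add: poly_act_le cf)
  ultimately show ?thesis by blast
qed

lemma gen_eigenspan_UNIV: "gen_eigenspan A = UNIV"
proof -
  have "v \<in> gen_eigenspan A" for v
  proof -
    obtain p where "p \<noteq> 0" "poly_act p (complex_matrix A) v = 0"
      using annihilating_polynomial by blast
    then show ?thesis
      by (metis poly_act_in_gen_eigenspan vec.span_zero)
  qed
  then show ?thesis by blast
qed

section \<open>The hyperbolic splitting\<close>

text \<open>Once the norm of \<open>w k\<close> is below \<open>e * (1 - cmod c)\<close>, the excess
  of \<open>cmod (x k)\<close> over \<open>e\<close> shrinks at least by the factor
  \<open>cmod c\<close> in every step.\<close>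

lemma tendsto_0_contracting_recursion:
  fixes x w :: "nat \<Rightarrow> complex"
  assumes rec: "\<And>k. x (Suc k) = c * x k + w k" and c: "cmod c < 1" and w: "w \<longlonglongrightarrow> 0"
  shows "x \<longlonglongrightarrow> 0"
proof (rule LIMSEQ_I)
  fix r :: real assume "0 < r"
  define e where "e = r / 2"
  have "0 < e * (1 - cmod c)" using c \<open>0 < r\<close> by (simp add: e_def)
  then obtain K where K: "\<And>k. k \<ge> K \<Longrightarrow> cmod (w k) < e * (1 - cmod c)"
    using LIMSEQ_D[OF w, of "e * (1 - cmod c)"] by auto
  have b: "cmod (x (K + n)) - e \<le> cmod c ^ n * cmod (x K)" for n
  proof (induction n)
    case 0
    show ?case using \<open>0 < r\<close> by (simp add: e_def)
  next
    case (Suc n)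
    have "cmod (x (K + Suc n)) \<le> cmod c * cmod (x (K + n)) + cmod (w (K + n))"
      using rec[of "K + n"] by (metis add_Suc_right norm_mult norm_triangle_ineq)
    also have "\<dots> \<le> cmod c * (cmod c ^ n * cmod (x K) + e) + e * (1 - cmod c)"
      using K[of "K + n"] Suc by (intro add_mono mult_left_mono) auto
    finally show ?case by (simp add: algebra_simps)
  qed
  have "(\<lambda>n. cmod c ^ n * cmod (x K)) \<longlonglongrightarrow> 0 * cmod (x K)"
    using c by (intro tendsto_intros LIMSEQ_realpow_zero) auto
  then obtain N where N: "\<And>n. n \<ge> N \<Longrightarrow> cmod c ^ n * cmod (x K) < e"
    using LIMSEQ_D[of "\<lambda>n. cmod c ^ n * cmod (x K)" 0 e] \<open>0 < r\<close> by (fastforce simp: e_def)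
  show "\<exists>no. \<forall>n\<ge>no. norm (x n - 0) < r"
  proof (intro exI[of _ "K + N"] allI impI)
    fix n assume "K + N \<le> n"
    then have "K + (n - K) = n" "N \<le> n - K" by simp_all
    then show "norm (x n - 0) < r"
      using b[of "n - K"] N[of "n - K"] by (simp add: e_def)
  qed
qed

lemma complex_matrix_mult: "complex_matrix (A ** B) = complex_matrix A ** complex_matrix B"
  by (simp add: vec_eq_iff matrix_matrix_mult_def)

lemma complex_matrix_mat: "complex_matrix (mat c) = mat (of_real c)"
  by (simp add: vec_eq_iff mat_def)

lemma Re_complex_matrix_vec:
  "(\<chi> i. Re ((complex_matrix A *v z) $ i)) = A *v (\<chi> i. Re (z $ i))"
  by (simp add: vec_eq_iff matrix_vector_mult_def)

lemma Re_mat_power_complex_vec: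
  "(\<chi> i. Re ((mat_power (complex_matrix A) k *v z) $ i)) = mat_power A k *v (\<chi> i. Re (z $ i))"
  by (induction k) (simp_all only: mat_power_Suc_vec Re_complex_matrix_vec, simp)

text \<open>A dynamical form of the stable subspace, applied to \<open>A\<close> and to its inverse.
  The scalar type is left open so that complex eigenvectors and their real parts can both be
  treated.\<close>

definition stable_set :: "'a::real_normed_field^'d^'d \<Rightarrow> ('a^'d) set" where
  "stable_set A = {x. (\<lambda>k. mat_power A k *v x) \<longlonglongrightarrow> 0}"

text \<open>Applying the \<open>k\<close>-th power of \<open>M\<close> to the equation for
  \<open>v\<close> turns each coordinate of the orbit into a contracting recursion driven by the
  orbit of \<open>w\<close>.\<close>

lemma stable_set_recursion:
  assumes w: "(\<lambda>k. mat_power M k *v w) \<longlonglongrightarrow> 0" and "cmod c < 1" and v: "M *v v = c *s v + w"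
  shows "(\<lambda>k. mat_power M k *v v) \<longlonglongrightarrow> (0::complex^'d)"
proof (rule vec_tendstoI)
  fix i
  have "mat_power M (Suc k) *v v = c *s (mat_power M k *v v) + mat_power M k *v w" for k
    by (simp only: mat_power_Suc_vec' v) (simp add: matrix_vector_right_distrib vector_scalar_commute)
  then show "(\<lambda>k. (mat_power M k *v v) $ i) \<longlonglongrightarrow> 0 $ i"
    using assms(2) tendsto_vec_nth[OF w, of i]
    by (simp add: tendsto_0_contracting_recursion[where c = c and w = "\<lambda>k. (mat_power M k *v w) $ i"]
        del: mat_power.simps)
qed

lemma gen_eigenspace_stable:
  assumes "v \<in> gen_eigenspace A \<mu>" "cmod \<mu> < 1"
  shows "v \<in> stable_set (complex_matrix A)"
  using assms(1)
proof (induction rule: gen_eigenspace_nilpotent_induct)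
  case (step v)
  then show ?case
    using assms(2) stable_set_recursion[where c = \<mu> and v = v and w = "(complex_matrix A - mat \<mu>) *v v"]
    by (simp add: diff_mat_vec stable_set_def)
qed (simp add: stable_set_def)

text \<open>With \<open>w = (A - \<mu>) v\<close> one has
  \<open>A' v = v / \<mu> - A' w / \<mu>\<close>. This is a recursion with factor of modulus less
  than 1, and the orbit of \<open>w\<close> under \<open>A'\<close> vanishes in the limit by
  induction.\<close>

lemma gen_eigenspace_unstable:
  assumes "v \<in> gen_eigenspace A \<mu>" "cmod \<mu> > 1" "A' ** A = mat 1"
  shows "v \<in> stable_set (complex_matrix A')"
  using assms(1)
proof (induction rule: gen_eigenspace_nilpotent_induct)
  case (step v)
  let ?M = "complex_matrix A" and ?N = "complex_matrix A'"
  let ?w = "(?M - mat \<mu>) *v v"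
  have \<mu>: "\<mu> \<noteq> 0" using assms(2) by auto
  have NM: "?N *v (?M *v x) = x" for x
    using assms(3) by (simp add: matrix_vector_mul_assoc complex_matrix_mult[symmetric] complex_matrix_mat)
  have "?N *v ?w = v - \<mu> *s (?N *v v)"
    by (simp add: diff_mat_vec matrix_vector_mult_diff_distrib NM vector_scalar_commute)
  then have eq: "?N *v v = inverse \<mu> *s v + (- inverse \<mu>) *s (?N *v ?w)"
    using \<mu> by (simp add: vec_eq_iff field_simps)
  have "(\<lambda>k. mat_power ?N (Suc k) *v ?w) \<longlonglongrightarrow> 0"
    using step(1) LIMSEQ_Suc unfolding stable_set_def by blast
  then have "(\<lambda>k. (mat_power ?N (Suc k) *v ?w) $ i) \<longlonglongrightarrow> 0" for i
    using tendsto_vec_nth by fastforce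
  then have "(\<lambda>k. (- inverse \<mu>) * (mat_power ?N (Suc k) *v ?w) $ i) \<longlonglongrightarrow> 0" for i
    by (rule tendsto_mult_right_zero)
  moreover have "(mat_power ?N k *v ((- inverse \<mu>) *s (?N *v ?w))) $ i
      = (- inverse \<mu>) * (mat_power ?N (Suc k) *v ?w) $ i" for k i
    by (simp only: vector_scalar_commute mat_power_Suc_vec' vector_smult_component)
  ultimately have "(\<lambda>k. mat_power ?N k *v ((- inverse \<mu>) *s (?N *v ?w))) \<longlonglongrightarrow> 0"
    by (intro vec_tendstoI) (simp only: zero_index)
  moreover have "cmod (inverse \<mu>) < 1"
    using assms(2) \<mu> by (simp add: norm_inverse inverse_less_1_iff)
  ultimately show ?case using stable_set_recursion eq unfolding stable_set_def by blast
qed (simp add: stable_set_def)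

lemma Re_stable_set:
  assumes "z \<in> stable_set (complex_matrix A)"
  shows "(\<chi> i. Re (z $ i)) \<in> stable_set A"
proof -
  have "(\<lambda>k. (\<chi> i. Re ((mat_power (complex_matrix A) k *v z) $ i))) \<longlonglongrightarrow> 0"
  proof (rule vec_tendstoI)
    fix i
    have "(\<lambda>k. Re ((mat_power (complex_matrix A) k *v z) $ i)) \<longlonglongrightarrow> Re (0 $ i)"
      using assms unfolding stable_set_def by (intro tendsto_intros) simp
    then show "(\<lambda>k. (\<chi> i. Re ((mat_power (complex_matrix A) k *v z) $ i)) $ i) \<longlonglongrightarrow> 0 $ i"
      by simp
  qed
  then show ?thesis by (simp add: stable_set_def Re_mat_power_complex_vec)
qed

lemma subspace_stable_set: "subspace (stable_set (A :: real^'d^'d))"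
proof (rule subspaceI)
  show "0 \<in> stable_set A" by (simp add: stable_set_def)
  show "x + y \<in> stable_set A" if "x \<in> stable_set A" "y \<in> stable_set A" for x y
    using that tendsto_add[of "\<lambda>k. mat_power A k *v x" 0 sequentially "\<lambda>k. mat_power A k *v y" 0]
    by (simp add: stable_set_def matrix_vector_right_distrib)
  show "c *\<^sub>R x \<in> stable_set A" if "x \<in> stable_set A" for x c
    using that tendsto_scaleR[of "\<lambda>k. c" c sequentially "\<lambda>k. mat_power A k *v x" 0]
    by (simp add: stable_set_def matrix_vector_mult_scaleR)
qed

lemma stable_set_image:
  assumes "x \<in> stable_set (A :: real^'d^'d)"
  shows "A *v x \<in> stable_set A"
  using assms LIMSEQ_Suc[of "\<lambda>k. mat_power A k *v x" 0]
  by (simp add: stable_set_def mat_power_Suc_vec' del: mat_power.simps)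

lemma stable_set_preimage:
  assumes "A *v x \<in> stable_set (A :: real^'d^'d)"
  shows "x \<in> stable_set A"
  using assms filterlim_sequentially_Suc[of "\<lambda>k. mat_power A k *v x" "nhds 0"]
  by (simp add: stable_set_def mat_power_Suc_vec' del: mat_power.simps)

section \<open>Stable and unstable subspaces and their projections\<close>

locale hyperbolic_iso =
  fixes A :: "real^'d^'d"
  assumes inv: "invertible A" and hyp: "hyperbolic_matrix A"
begin

definition "A' = matrix_inv A"
definition "Es = stable_set A"
text \<open>Unstable vectors are those contracted by the inverse;
  \<open>unstable_subspace_eq\<close> identifies this set with the span of the generalized
  eigenspaces.\<close>

definition "Eu = stable_set A'"

lemma A'A: "A' ** A = mat 1" and AA': "A ** A' = mat 1"
proof -
  have "A ** A' = mat 1 \<and> A' ** A = mat 1"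
    using inv unfolding A'_def matrix_inv_def invertible_def by (rule someI_ex)
  then show "A' ** A = mat 1" "A ** A' = mat 1" by blast+
qed

lemma A'A_vec: "A' *v (A *v x) = x" and AA'_vec: "A *v (A' *v x) = x"
  by (simp_all add: matrix_vector_mul_assoc A'A AA')

lemma subspace_Es: "subspace Es" and subspace_Eu: "subspace Eu"
  by (simp_all add: Es_def Eu_def subspace_stable_set)

lemma A_Es: "x \<in> Es \<Longrightarrow> A *v x \<in> Es"
  and A_Eu: "x \<in> Eu \<Longrightarrow> A *v x \<in> Eu" and A'_Eu: "x \<in> Eu \<Longrightarrow> A' *v x \<in> Eu"
  unfolding Es_def Eu_def
  using stable_set_image stable_set_preimage[of A' "A *v x"]
  by (auto simp: A'A_vec AA'_vec)

lemma mat_power_Es: "x \<in> Es \<Longrightarrow> mat_power A k *v x \<in> Es"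
  and mat_power_A'_Eu: "x \<in> Eu \<Longrightarrow> mat_power A' k *v x \<in> Eu"
  and mat_power_Eu: "x \<in> Eu \<Longrightarrow> mat_power A k *v x \<in> Eu"
  by (induction k) (simp_all add: mat_power_Suc_vec A_Es A'_Eu A_Eu del: mat_power.simps(2))

text \<open>On the intersection both the \<open>k\<close>-th power of \<open>A\<close> and its
  inverse shrink norms by 1/2 for large \<open>k\<close>, so their composition, the identity,
  shrinks them by 1/4.\<close>

lemma Es_Int_Eu: "x \<in> Es \<Longrightarrow> x \<in> Eu \<Longrightarrow> x = 0"
proof -
  assume x: "x \<in> Es" "x \<in> Eu"
  have W: "subspace (Es \<inter> Eu)" by (simp add: subspace_Es subspace_Eu subspace_inter)
  have "\<forall>\<^sub>F k in sequentially. \<forall>x\<in>Es \<inter> Eu. norm (mat_power A k *v x) \<le> (1/2) * norm x"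
    by (rule linear_family_small_on_subspace[OF W]) (auto simp: Es_def stable_set_def)
  moreover have "\<forall>\<^sub>F k in sequentially. \<forall>x\<in>Es \<inter> Eu. norm (mat_power A' k *v x) \<le> (1/2) * norm x"
    by (rule linear_family_small_on_subspace[OF W]) (auto simp: Eu_def stable_set_def)
  ultimately obtain k where k: "\<And>x. x \<in> Es \<inter> Eu \<Longrightarrow> norm (mat_power A k *v x) \<le> (1/2) * norm x"
    "\<And>x. x \<in> Es \<inter> Eu \<Longrightarrow> norm (mat_power A' k *v x) \<le> (1/2) * norm x"
    by (metis (mono_tags, lifting) eventually_conj eventually_happens' trivial_limit_sequentially)
  have "norm x = norm (mat_power A' k *v (mat_power A k *v x))"
    by (simp add: mat_power_left_inverse_vec A'A)
  also have "\<dots> \<le> (1/2) * norm (mat_power A k *v x)"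
    using x by (intro k) (auto intro: mat_power_Es mat_power_Eu)
  also have "\<dots> \<le> (1/2) * ((1/2) * norm x)" using x by (intro mult_left_mono k) auto
  finally show "x = 0" by simp
qed

lemma unstable_subspace_subset: "unstable_subspace A \<subseteq> Eu"
  unfolding unstable_subspace_def
proof (rule span_minimal)
  show "(\<Union>\<mu>\<in>{\<mu>. is_eigenvalue A \<mu> \<and> 1 < cmod \<mu>}. real_gen_eigenspace A \<mu>) \<subseteq> Eu"
    using gen_eigenspace_unstable[OF _ _ A'A] Re_stable_set
    unfolding Eu_def real_gen_eigenspace_def by blast
qed (rule subspace_Eu)

text \<open>The claim holds for real parts of generalized eigenvectors, where hyperbolicity leaves
  only moduli above or below 1. It extends to all vectors since the generalized eigenvectors span
  the complex space.\<close>

lemma splitting_exists: "\<exists>y\<in>unstable_subspace A. x - y \<in> Es"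
proof -
  let ?re = "\<lambda>z::complex^'d. \<chi> i. Re (z $ i)"
  \<comment> \<open>Taking real parts is only real-linear. Quantifying over all complex multiples
    \<open>c *s z\<close> makes \<open>?Z\<close> a complex subspace.\<close>
  let ?Z = "{z. \<forall>c. \<exists>y\<in>unstable_subspace A. ?re (c *s z) - y \<in> Es}"
  have sub: "subspace (unstable_subspace A)" by (simp add: unstable_subspace_def)
  have "vec.subspace ?Z"
    unfolding vec.subspace_def mem_Collect_eq
  proof (intro conjI allI impI ballI)
    show "\<exists>y\<in>unstable_subspace A. ?re (c *s 0) - y \<in> Es" for c
      using subspace_0[OF sub] subspace_0[OF subspace_Es]
      by (intro bexI[of _ 0]) (auto simp: zero_vec_def)
    show "\<exists>y\<in>unstable_subspace A. ?re (d *s (c *s z)) - y \<in> Es"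
      if "z \<in> ?Z" for z c d
      using that unfolding mem_Collect_eq vector_smult_assoc by blast
    fix z w c
    assume "z \<in> ?Z" "w \<in> ?Z"
    then obtain y y' where y: "y \<in> unstable_subspace A" "?re (c *s z) - y \<in> Es"
       "y' \<in> unstable_subspace A" "?re (c *s w) - y' \<in> Es" by blast
    have eq: "?re (c *s (z + w)) - (y + y') = (?re (c *s z) - y) + (?re (c *s w) - y')"
      by (simp add: vec_eq_iff algebra_simps)
    have "?re (c *s (z + w)) - (y + y') \<in> Es"
      unfolding eq using y subspace_Es by (blast intro: subspace_add)
    then show "\<exists>y\<in>unstable_subspace A. ?re (c *s (z + w)) - y \<in> Es"
      using y sub by (blast intro: subspace_add)
  qed
  moreover have "gen_eigenspace A \<nu> \<subseteq> ?Z" for \<nu>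
  proof
    fix z assume z: "z \<in> gen_eigenspace A \<nu>"
    have "\<exists>y\<in>unstable_subspace A. ?re (c *s z) - y \<in> Es" for c
    proof -
      have cz: "c *s z \<in> gen_eigenspace A \<nu>"
        using z gen_eigenspace_subspace vec.subspace_scale by blast
      \<comment> \<open>For \<open>c *s z = 0\<close> the number \<nu> need not be an eigenvalue,
        and hyperbolicity says nothing about its modulus.\<close>
      consider "c *s z = 0" | "is_eigenvalue A \<nu>" "cmod \<nu> > 1" | "cmod \<nu> < 1"
        using gen_eigenspace_eigenvalue[OF cz] hyp unfolding hyperbolic_matrix_def
        by (metis linorder_neqE_linordered_idom)
      then show ?thesis
      proof cases
        case 1
        have "?re (c *s z) = 0" by (simp add: 1 vec_eq_iff)
        then show ?thesis
          using subspace_0[OF sub] subspace_0[OF subspace_Es] by (intro bexI[of _ 0]) simp_all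
      next
        case 2
        then have "?re (c *s z) \<in> unstable_subspace A"
          unfolding unstable_subspace_def real_gen_eigenspace_def using cz
          by (intro span_base) blast
        then show ?thesis
          using subspace_0[OF subspace_Es] by (intro bexI[of _ "?re (c *s z)"]) simp_all
      next
        case 3
        then have "?re (c *s z) \<in> Es"
          using gen_eigenspace_stable[OF cz] Re_stable_set unfolding Es_def by blast
        then show ?thesis using subspace_0[OF sub] by (intro bexI[of _ 0]) simp_all
      qed
    qed
    then show "z \<in> ?Z" by blast
  qed
  ultimately have "gen_eigenspan A \<subseteq> ?Z" by (intro vec.span_minimal) auto
  then have "(\<chi> i. complex_of_real (x $ i)) \<in> ?Z" unfolding gen_eigenspan_UNIV by blast
  then have "\<exists>y\<in>unstable_subspace A. ?re (1 *s (\<chi> i. complex_of_real (x $ i))) - y \<in> Es" by blast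
  then show ?thesis by (simp add: vec_eq_iff)
qed

lemma unstable_subspace_eq: "unstable_subspace A = Eu"
proof
  show "Eu \<subseteq> unstable_subspace A"
  proof
    fix x assume x: "x \<in> Eu"
    obtain y where y: "y \<in> unstable_subspace A" "x - y \<in> Es" using splitting_exists by blast
    then have "x - y = 0" using x Es_Int_Eu unstable_subspace_subset subspace_Eu subspace_diff by blast
    then show "x \<in> unstable_subspace A" using y by simp
  qed
qed (rule unstable_subspace_subset)

text \<open>The projection onto \<open>Eu\<close> along \<open>Es\<close>; \<open>pu_unique\<close>
  shows that the choice is determined.\<close>

definition pu :: "real^'d \<Rightarrow> real^'d" where
  "pu x = (SOME y. y \<in> Eu \<and> x - y \<in> Es)"

definition ps :: "real^'d \<Rightarrow> real^'d" where "ps x = x - pu x"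

lemma pu_in: "pu x \<in> Eu" and ps_in: "ps x \<in> Es"
proof -
  have "\<exists>y. y \<in> Eu \<and> x - y \<in> Es" using splitting_exists unstable_subspace_eq by blast
  then have "pu x \<in> Eu \<and> x - pu x \<in> Es" unfolding pu_def by (rule someI_ex)
  then show "pu x \<in> Eu" "ps x \<in> Es" by (auto simp: ps_def)
qed

lemma pu_unique:
  assumes "y \<in> Eu" "x - y \<in> Es"
  shows "pu x = y"
proof -
  have "pu x - y \<in> Eu" using assms(1) pu_in subspace_Eu subspace_diff by blast
  moreover have "(x - y) - (x - pu x) \<in> Es"
    using assms(2) ps_in[of x] subspace_Es subspace_diff unfolding ps_def by blast
  then have "pu x - y \<in> Es" by simp
  ultimately have "pu x - y = 0" using Es_Int_Eu by blast
  then show ?thesis by simp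
qed

lemma pu_plus_ps: "pu x + ps x = x" by (simp add: ps_def)

lemma pu_Eu: "x \<in> Eu \<Longrightarrow> pu x = x"
  by (rule pu_unique) (auto simp: subspace_0 subspace_Es)

lemma pu_Es: "x \<in> Es \<Longrightarrow> pu x = 0"
  by (rule pu_unique) (auto simp: subspace_0 subspace_Eu)

lemma ps_Es: "x \<in> Es \<Longrightarrow> ps x = x" by (simp add: ps_def pu_Es)

lemma linear_pu: "linear pu"
proof (rule linearI)
  show "pu (x + y) = pu x + pu y" for x y
  proof (rule pu_unique)
    show "pu x + pu y \<in> Eu" using pu_in subspace_Eu subspace_add by blast
    have "ps x + ps y \<in> Es" using ps_in subspace_Es subspace_add by blast
    then show "x + y - (pu x + pu y) \<in> Es" by (simp add: ps_def algebra_simps)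
  qed
  show "pu (c *\<^sub>R x) = c *\<^sub>R pu x" for c x
  proof (rule pu_unique)
    show "c *\<^sub>R pu x \<in> Eu" using pu_in subspace_Eu subspace_scale by blast
    have "c *\<^sub>R ps x \<in> Es" using ps_in subspace_Es subspace_scale by blast
    then show "c *\<^sub>R x - c *\<^sub>R pu x \<in> Es" by (simp add: ps_def algebra_simps)
  qed
qed

lemma linear_ps: "linear ps"
  unfolding ps_def by (intro linear_compose_sub linear_pu linear_ident)

lemma pu_A: "pu (A *v x) = A *v pu x"
proof (rule pu_unique)
  show "A *v pu x \<in> Eu" by (intro A_Eu pu_in)
  have "A *v ps x \<in> Es" by (intro A_Es ps_in)
  then show "A *v x - A *v pu x \<in> Es" by (simp add: ps_def matrix_vector_mult_diff_distrib)
qed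

lemma pu_mat_power: "pu (mat_power A k *v x) = mat_power A k *v pu x"
  by (induction k) (simp_all add: mat_power_Suc_vec pu_A del: mat_power.simps(2))

lemma ps_mat_power: "ps (mat_power A k *v x) = mat_power A k *v ps x"
  by (simp add: ps_def pu_mat_power matrix_vector_mult_diff_distrib)

text \<open>Composition with \<open>ps\<close> replaces restriction to \<open>Es\<close> by maps of
  the whole space, to which operator norms apply. The semigroup law holds because \<open>ps\<close>
  fixes the invariant space \<open>Es\<close>.\<close>

lemma summable_stable: "summable (\<lambda>k. onorm (\<lambda>x. mat_power A k *v ps x))"
proof (rule summable_onorm_semigroup)
  show "linear (\<lambda>x. mat_power A k *v ps x)" for k
    using linear_compose[OF linear_ps matrix_vector_mul_linear, unfolded o_def] .
  show "(\<lambda>k. mat_power A k *v ps x) \<longlonglongrightarrow> 0" for x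
    using ps_in[of x] by (simp add: Es_def stable_set_def)
  show "mat_power A (m + n) *v ps x = mat_power A m *v ps (mat_power A n *v ps x)" for m n x
    by (simp add: mat_power_add_vec ps_Es ps_in mat_power_Es)
qed

lemma summable_unstable: "summable (\<lambda>k. onorm (\<lambda>x. mat_power A' k *v pu x))"
proof (rule summable_onorm_semigroup)
  show "linear (\<lambda>x. mat_power A' k *v pu x)" for k
    using linear_compose[OF linear_pu matrix_vector_mul_linear, unfolded o_def] .
  show "(\<lambda>k. mat_power A' k *v pu x) \<longlonglongrightarrow> 0" for x
    using pu_in[of x] by (simp add: Eu_def stable_set_def)
  show "mat_power A' (m + n) *v pu x = mat_power A' m *v pu (mat_power A' n *v pu x)" for m n x
    by (simp add: mat_power_add_vec pu_Eu pu_in mat_power_A'_Eu)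
qed

end

section \<open>The unstable determinant\<close>

text \<open>The dimensions of \<open>S\<close> and \<open>W\<close> add up to
  \<open>CARD('d)\<close>, and a spanning set with at most that many elements is a basis.\<close>

lemma adapted_basis:
  fixes S W :: "(real^'d) set"
  assumes "subspace S" "subspace W" "S \<inter> W = {0}" "\<And>x. \<exists>y\<in>S. x - y \<in> W"
    and bs: "independent bs" "span bs = S"
  obtains bw where "bw \<subseteq> W" "independent (bs \<union> bw)" "span (bs \<union> bw) = UNIV"
    "card (bs \<union> bw) = CARD('d)"
proof -
  obtain bw where bw: "bw \<subseteq> W" "independent bw" "W \<subseteq> span bw" "card bw = dim W"
    using basis_exists by blast
  have fin: "finite bs" "finite bw" using bs bw by (auto intro: independent_imp_finite)
  have SW: "{x + y |x y. x \<in> S \<and> y \<in> W} = UNIV"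
  proof -
    have "x \<in> {x + y |x y. x \<in> S \<and> y \<in> W}" for x
    proof -
      obtain y where "y \<in> S" "x - y \<in> W" using assms(4) by blast
      moreover have "x = y + (x - y)" by simp
      ultimately show ?thesis by blast
    qed
    then show ?thesis by blast
  qed
  have "UNIV \<subseteq> span (bs \<union> bw)"
  proof
    fix x
    obtain y where y: "y \<in> S" "x - y \<in> W" using assms(4) by blast
    then have "y \<in> span (bs \<union> bw)" "x - y \<in> span (bs \<union> bw)"
      using bs(2) bw(3) span_mono[of bs "bs \<union> bw"] span_mono[of bw "bs \<union> bw"] by auto
    then have "y + (x - y) \<in> span (bs \<union> bw)" by (rule span_add)
    then show "x \<in> span (bs \<union> bw)" by simp
  qed
  then have span: "span (bs \<union> bw) = UNIV" by blast
  have "dim S + dim W = CARD('d)"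
    using dim_sums_Int[OF assms(1,2)] by (simp add: SW assms(3))
  moreover have "dim S = card bs" using bs dim_span_eq_card_independent by fastforce
  ultimately have le: "card (bs \<union> bw) \<le> CARD('d)"
    using card_Un_le[of bs bw] bw(4) by simp
  have "independent (bs \<union> bw)"
    using card_le_dim_spanning[of "bs \<union> bw" UNIV] span fin le by simp
  moreover from this have "card (bs \<union> bw) = CARD('d)"
    using span dim_eq_card[of "bs \<union> bw" UNIV] by simp
  ultimately show thesis using that bw(1) span by blast
qed

text \<open>\<open>T\<close> is block diagonal with respect to the decomposition, and the identity block leaves only
  the permutations of the basis of \<open>S\<close> in the Leibniz formula.\<close>

lemma det_on_eq_det:
  fixes f T :: "real^'d \<Rightarrow> real^'d"
  assumes S: "subspace S" and W: "subspace W" "S \<inter> W = {0}" "\<And>x. \<exists>y\<in>S. x - y \<in> W"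
    and lin: "linear T" and Tf: "\<And>x. x \<in> S \<Longrightarrow> T x = f x" "\<And>x. x \<in> S \<Longrightarrow> f x \<in> S"
    and TW: "\<And>x. x \<in> W \<Longrightarrow> T x = x"
  shows "det_on S f = det (matrix T)"
proof -
  define bs where "bs = (SOME bs. independent bs \<and> span bs = S)"
  have "\<exists>bs. independent bs \<and> span bs = S"
    using S by (metis basis_exists span_subspace)
  then have bs: "independent bs" "span bs = S"
    unfolding bs_def by (metis (mono_tags, lifting) someI_ex)+
  obtain bw where bw: "bw \<subseteq> W" "independent (bs \<union> bw)" "span (bs \<union> bw) = UNIV"
      "card (bs \<union> bw) = CARD('d)"
    using adapted_basis[OF S W bs] by blast
  define B where "B = bs \<union> bw"
  have B: "independent B" "span B = UNIV" "finite B" "bs \<subseteq> B"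
    using bw independent_imp_finite by (auto simp: B_def simp del: finite_Un)
  obtain e :: "'d \<Rightarrow> real^'d" where e: "bij_betw e UNIV B"
    using finite_same_card_bij[of "UNIV :: 'd set" B] bw(4) B(3) unfolding B_def by auto
  \<comment> \<open>\<open>P\<close> has the adapted basis as its columns and \<open>N\<close> is
    the matrix of \<open>T\<close> in that basis, so \<open>matrix T\<close> and \<open>N\<close>
    are similar.\<close>
  define P :: "real^'d^'d" where "P = (\<chi> i j. e j $ i)"
  define N :: "real^'d^'d" where "N = (\<chi> i j. representation B (T (e j)) (e i))"
  have col: "column j P = e j" for j by (simp add: column_def P_def vec_eq_iff)
  have "columns P = B" using e by (auto simp: columns_def col bij_betw_def)
  then have "\<exists>Q. P ** Q = mat 1"
    using B(2) by (simp add: matrix_right_invertible_span_columns span_vec_eq)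
  then have detP: "det P \<noteq> 0"
    using invertible_det_nz invertible_right_inverse by blast
  have "matrix T ** P = P ** N"
  proof -
    have "(matrix T ** P) $ i $ j = (P ** N) $ i $ j" for i j
    proof -
      have "T (e j) = (\<Sum>b\<in>B. representation B (T (e j)) b *\<^sub>R b)"
        using B by (simp add: sum_representation_eq)
      also have "\<dots> = (\<Sum>k\<in>UNIV. representation B (T (e j)) (e k) *\<^sub>R e k)"
        using sum.reindex_bij_betw[OF e, of "\<lambda>b. representation B (T (e j)) b *\<^sub>R b"] by simp
      finally have Te: "T (e j) = (\<Sum>k\<in>UNIV. representation B (T (e j)) (e k) *\<^sub>R e k)" .
      have "T (e j) $ i = (\<Sum>k\<in>UNIV. representation B (T (e j)) (e k) * e k $ i)"
        using arg_cong[OF Te, of "\<lambda>v. v $ i"] by (simp add: sum_component)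
      moreover have "(matrix T ** P) $ i $ j = (matrix T *v e j) $ i"
        by (simp add: matrix_matrix_mult_def matrix_vector_mult_def P_def)
      ultimately show ?thesis
        using fun_cong[OF matrix_vector_mul(2)[OF lin], of "e j"]
          by (simp add: matrix_matrix_mult_def P_def N_def mult.commute)
    qed
    then show ?thesis by (simp add: vec_eq_iff)
  qed
  then have "det (matrix T) * det P = det P * det N" by (metis det_mul)
  then have "det (matrix T) = det N" using detP by simp
  \<comment> \<open>The Leibniz formula is taken for the transpose, so that \<open>p\<close> acts on
    the row index as in \<open>det_on\<close>.\<close>
  also have "\<dots> = (\<Sum>p | p permutes UNIV. of_int (sign p) * (\<Prod>i\<in>UNIV. N $ p i $ i))"
    using det_transpose[of N] by (simp add: det_def transpose_def)
  also have "\<dots> = (\<Sum>p | p permutes {j. e j \<in> bs}. of_int (sign p) * (\<Prod>i\<in>UNIV. N $ p i $ i))"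
  proof (rule sum.mono_neutral_right)
    show "finite {p. p permutes (UNIV :: 'd set)}" by (simp add: finite_permutations)
    show "{p. p permutes {j. e j \<in> bs}} \<subseteq> {p. p permutes UNIV}"
      using permutes_subset by blast
    show "\<forall>p\<in>{p. p permutes UNIV} - {p. p permutes {j. e j \<in> bs}}.
        of_int (sign p) * (\<Prod>i\<in>UNIV. N $ p i $ i) = 0"
    proof
      fix p assume p: "p \<in> {p. p permutes UNIV} - {p. p permutes {j. e j \<in> bs}}"
      then obtain j where j: "e j \<notin> bs" "p j \<noteq> j"
        using permutes_superset[of p UNIV "{j. e j \<in> bs}"] by auto
      have eB: "e j \<in> B" "e (p j) \<in> B" using e by (auto simp: bij_betw_def)
      then have "T (e j) = e j" using j(1) bw(1) TW by (auto simp: B_def)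
      moreover have "e (p j) \<noteq> e j" using j(2) e by (auto simp: bij_betw_def inj_def)
      ultimately have "N $ p j $ j = 0"
        using representation_basis[OF B(1) eB(1)] by (simp add: N_def)
      then have "(\<Prod>i\<in>UNIV. N $ p i $ i) = 0" by (intro prod_zero) auto
      then show "of_int (sign p) * (\<Prod>i\<in>UNIV. N $ p i $ i) = 0" by simp
    qed
  qed
  \<comment> \<open>Permutations of the indices of \<open>bs\<close> correspond to permutations of
    \<open>bs\<close> by conjugation with \<open>e\<close>, which preserves signs.\<close>
  also have "\<dots> = (\<Sum>q | q permutes bs. of_int (sign q) * (\<Prod>b\<in>bs. representation bs (f b) (q b)))"
  proof (rule sum.reindex_bij_witness[where
      i = "map_permutation bs (inv_into {j. e j \<in> bs} e)" and j = "map_permutation {j. e j \<in> bs} e"])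
    let ?J = "{j. e j \<in> bs}"
    have inj: "inj_on e ?J" using e by (auto simp: bij_betw_def intro: inj_on_subset)
    have img: "e ` ?J = bs" using e B(4) by (auto simp: bij_betw_def)
    have eJ: "bij_betw e ?J bs" using inj img by (simp add: bij_betw_def)
    fix q assume q: "q \<in> {q. q permutes bs}"
    show "map_permutation ?J e (map_permutation bs (inv_into ?J e) q) = q"
      using q bij_betw_inv_into[OF eJ]
      by (intro map_permutation_compose_inv[where A = bs and B = ?J])
        (auto simp: f_inv_into_f img inj_on_inv_into)
    show "map_permutation bs (inv_into ?J e) q \<in> {p. p permutes ?J}"
      using q bij_betw_inv_into[OF eJ] map_permutation_permutes by blast
  next
    let ?J = "{j. e j \<in> bs}"
    have inj: "inj_on e ?J" using e by (auto simp: bij_betw_def intro: inj_on_subset)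
    have img: "e ` ?J = bs" using e B(4) by (auto simp: bij_betw_def)
    have eJ: "bij_betw e ?J bs" using inj img by (simp add: bij_betw_def)
    fix p assume "p \<in> {p. p permutes ?J}"
    then have p: "p permutes ?J" by simp
    show "map_permutation bs (inv_into ?J e) (map_permutation ?J e p) = p"
      using p eJ inj by (intro map_permutation_compose_inv[where A = ?J and B = bs]) auto
    show "map_permutation ?J e p \<in> {q. q permutes bs}"
      using p eJ map_permutation_permutes by blast
    have "evenperm (map_permutation ?J e p) = evenperm p"
      using p inj by (intro evenperm_map_permutation) auto
    then have sgn: "sign (map_permutation ?J e p) = sign p" by (simp add: sign_def)
    have "(\<Prod>b\<in>bs. representation bs (f b) (map_permutation ?J e p b))
        = (\<Prod>i\<in>?J. representation bs (f (e i)) (map_permutation ?J e p (e i)))"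
      using prod.reindex_bij_betw[OF eJ, symmetric] by fast
    also have "\<dots> = (\<Prod>i\<in>?J. N $ p i $ i)"
    proof (rule prod.cong)
      fix i assume i: "i \<in> ?J"
      then have "e i \<in> S" using bs(2) span_base by auto
      then have "representation B (T (e i)) = representation bs (f (e i))"
        using Tf[of "e i"] bs(2) representation_extend[OF B(1) _ B(4)] by simp
      moreover have "map_permutation ?J e p (e i) = e (p i)"
        using inj i by (rule map_permutation_apply)
      ultimately show "representation bs (f (e i)) (map_permutation ?J e p (e i)) = N $ p i $ i"
        by (simp add: N_def)
    qed simp
    also have "\<dots> = (\<Prod>i\<in>UNIV. N $ p i $ i)"
    proof (rule prod.mono_neutral_left)
      show "\<forall>i\<in>UNIV - ?J. N $ p i $ i = 1"
      proof
        fix i assume "i \<in> UNIV - ?J"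
        then have i: "e i \<notin> bs" "p i = i" using p by (auto simp: permutes_not_in)
        have eB: "e i \<in> B" using e by (auto simp: bij_betw_def)
        then have "T (e i) = e i" using i(1) bw(1) TW by (auto simp: B_def)
        then show "N $ p i $ i = 1"
          using representation_basis[OF B(1) eB] i(2) by (simp add: N_def)
      qed
    qed auto
    finally show "of_int (sign (map_permutation ?J e p)) *
        (\<Prod>b\<in>bs. representation bs (f b) (map_permutation ?J e p b))
        = of_int (sign p) * (\<Prod>i\<in>UNIV. N $ p i $ i)" by (simp add: sgn)
  qed
  also have "\<dots> = det_on S f" by (simp add: det_on_def bs_def Let_def)
  finally show ?thesis by simp
qed

section \<open>The unstable determinant as the determinant of a map of the whole space\<close>

context hyperbolic_iso
begin

text \<open>Extending \<open>A\<close> on \<open>Eu\<close> by the identity on \<open>Es\<close>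
  keeps the determinant and lets Lebesgue measure on the whole space detect the unstable expansion
  alone.\<close>

definition T :: "real^'d^'d" where "T = matrix (\<lambda>x. A *v pu x + ps x)"

definition T' :: "real^'d^'d" where "T' = matrix (\<lambda>x. A' *v pu x + ps x)"

lemma T_vec: "T *v x = A *v pu x + ps x"
proof -
  have "linear (\<lambda>x. A *v pu x + ps x)"
    by (intro linear_compose_add linear_ps linear_compose[OF linear_pu matrix_vector_mul_linear, unfolded o_def])
  then show ?thesis unfolding T_def by (rule fun_cong[OF matrix_vector_mul(2)])
qed

lemma T'_vec: "T' *v x = A' *v pu x + ps x"
proof -
  have "linear (\<lambda>x. A' *v pu x + ps x)"
    by (intro linear_compose_add linear_ps linear_compose[OF linear_pu matrix_vector_mul_linear, unfolded o_def])
  then show ?thesis unfolding T'_def by (rule fun_cong[OF matrix_vector_mul(2)])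
qed

lemma det_unstable_eq: "det_unstable A = det T"
proof -
  have "linear (\<lambda>x. A *v pu x + ps x)"
    by (intro linear_compose_add linear_ps linear_compose[OF linear_pu matrix_vector_mul_linear, unfolded o_def])
  moreover have "Eu \<inter> Es = {0}"
    using Es_Int_Eu subspace_0[OF subspace_Es] subspace_0[OF subspace_Eu] by blast
  ultimately show ?thesis
    unfolding det_unstable_def unstable_subspace_eq T_def
    by (intro det_on_eq_det[where W = Es])
      (auto simp: subspace_Eu subspace_Es pu_Eu ps_def pu_Es A_Eu
        intro: bexI[OF _ pu_in] ps_in[unfolded ps_def])
qed

lemma mat_power_T: "mat_power T k *v x = mat_power A k *v pu x + ps x"
proof (induction k)
  case (Suc k)
  have "pu (mat_power A k *v pu x + ps x) = mat_power A k *v pu x"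
    by (rule pu_unique) (auto intro: mat_power_Eu pu_in simp: ps_in)
  moreover from this have "ps (mat_power A k *v pu x + ps x) = ps x"
    by (simp add: ps_def[of "mat_power A k *v pu x + ps x"])
  ultimately show ?case using Suc by (simp only: mat_power_Suc_vec T_vec)
qed (simp add: pu_plus_ps)

lemma mat_power_T': "mat_power T' k *v x = mat_power A' k *v pu x + ps x"
proof (induction k)
  case (Suc k)
  have "pu (mat_power A' k *v pu x + ps x) = mat_power A' k *v pu x"
    by (rule pu_unique) (auto intro: mat_power_A'_Eu pu_in simp: ps_in)
  moreover from this have "ps (mat_power A' k *v pu x + ps x) = ps x"
    by (simp add: ps_def[of "mat_power A' k *v pu x + ps x"])
  ultimately show ?case using Suc by (simp only: mat_power_Suc_vec T'_vec)
qed (simp add: pu_plus_ps)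

lemma T'T: "T' ** T = mat 1"
proof -
  have "T' *v (T *v x) = x" for x
  proof -
    have "pu (A *v pu x + ps x) = A *v pu x"
      by (rule pu_unique) (auto intro: A_Eu pu_in simp: ps_in)
    moreover from this have "ps (A *v pu x + ps x) = ps x"
      by (simp add: ps_def[of "A *v pu x + ps x"])
    ultimately show ?thesis by (simp add: T_vec T'_vec A'A_vec pu_plus_ps)
  qed
  then show ?thesis by (simp add: matrix_vector_mul_assoc matrix_eq)
qed

lemma det_T_nonzero: "det T \<noteq> 0"
  using T'T invertible_det_nz invertible_left_inverse by blast

end

section \<open>Lebesgue measure of linear images\<close>

text \<open>Reduces the two volume-preserving elementary maps, coordinate transpositions and shears,
  to boxes.\<close>

lemma lmeasurable_image_if_cbox_preserved:
  fixes f :: "real^'n \<Rightarrow> real^'n"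
  assumes "linear f" "\<And>a b. measure lebesgue (f ` cbox a b) = measure lebesgue (cbox a b)"
    and "\<bar>det (matrix f)\<bar> = 1" "S \<in> lmeasurable"
  shows "f ` S \<in> lmeasurable \<and> measure lebesgue (f ` S) = \<bar>det (matrix f)\<bar> * measure lebesgue S"
  using measure_linear_sufficient[of f S 1] assms by simp

lemma image_involution:
  assumes "\<And>x. h (h x) = x"
  shows "h ` S = {x. h x \<in> S}"
  using assms by (auto, metis imageI)

text \<open>The library states this for index types of class \<open>wellorder\<close> only.\<close>

lemma lmeasurable_linear_image:
  fixes f :: "real^'n \<Rightarrow> real^'n"
  assumes "linear f" "S \<in> lmeasurable"
  shows "f ` S \<in> lmeasurable \<and> measure lebesgue (f ` S) = \<bar>det (matrix f)\<bar> * measure lebesgue S"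
proof -
  let ?P = "\<lambda>f :: real^'n \<Rightarrow> real^'n. \<forall>S\<in>lmeasurable.
    f ` S \<in> lmeasurable \<and> measure lebesgue (f ` S) = \<bar>det (matrix f)\<bar> * measure lebesgue S"
  have "?P f" using assms(1)
  proof (rule induct_linear_elementary)
    fix f g :: "real^'n \<Rightarrow> real^'n"
    assume "linear f" "linear g" "?P f" "?P g"
    then show "?P (f \<circ> g)"
      unfolding image_comp[symmetric] matrix_compose[OF \<open>linear g\<close> \<open>linear f\<close>] det_mul abs_mult
      by simp
  next
    fix f :: "real^'n \<Rightarrow> real^'n" and i
    assume f: "linear f" "\<And>x. f x $ i = 0"
    have "row i (matrix f) = 0" by (simp add: row_def matrix_def f(2) vec_eq_iff)
    then have "det (matrix f) = 0" by (rule det_zero_row)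
    moreover have "negligible (f ` S)" for S
      by (rule negligible_subset[OF negligible_standard_hyperplane_cart[of i]]) (auto simp: f(2))
    ultimately show "?P f" by (simp add: negligible_iff_measure)
  next
    fix c :: "'n \<Rightarrow> real"
    have "det (matrix (\<lambda>x. \<chi> i. c i * x $ i)) = prod c UNIV"
      by (subst det_diagonal) (auto simp: matrix_def axis_def)
    then show "?P (\<lambda>x. \<chi> i. c i * x $ i)"
      by (simp add: measurable_stretch measure_stretch)
  next
    fix m n :: 'n
    let ?t = "Transposition.transpose m n"
    let ?h = "\<lambda>x :: real^'n. \<chi> i. x $ ?t i"
    have lin: "linear ?h" by (rule linearI) (simp_all add: vec_eq_iff)
    have hh: "?h (?h x) = x" for x by (simp add: vec_eq_iff)
    then have "?h \<circ> ?h = id" by (simp add: fun_eq_iff)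
    then have "matrix ?h ** matrix ?h = mat 1"
      using matrix_compose[OF lin lin] by (simp only: matrix_id_mat_1)
    then have "det (matrix ?h) * det (matrix ?h) = 1" by (metis det_I det_mul)
    then have det: "\<bar>det (matrix ?h)\<bar> = 1" by (auto simp: square_eq_1_iff)
    have bij: "bij_betw ?t UNIV UNIV" by (rule permutes_imp_bij) (simp add: permutes_swap_id)
    have "measure lebesgue (?h ` cbox a b) = measure lebesgue (cbox a b)" for a b
    proof -
      have "cbox (?h a) (?h b) = {x. ?h x \<in> cbox a b}"
        unfolding set_eq_iff mem_Collect_eq by (simp add: mem_box_cart) (metis transpose_involutory)
      then have "?h ` cbox a b = cbox (?h a) (?h b)"
        using image_involution[of ?h "cbox a b", OF hh] by simp
      moreover have "cbox (?h a) (?h b) = {} \<longleftrightarrow> cbox a b = {}" using calculation by blast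
      moreover have "(\<Prod>i\<in>UNIV. ?h b $ i - ?h a $ i) = (\<Prod>i\<in>UNIV. b $ i - a $ i)"
        using prod.reindex_bij_betw[OF bij, of "\<lambda>i. b $ i - a $ i"] by simp
      ultimately show ?thesis by (simp add: content_cbox_if_cart)
    qed
    then show "?P ?h" 
      by (intro ballI lmeasurable_image_if_cbox_preserved lin det)
  next
    fix m n :: 'n
    assume mn: "m \<noteq> n"
    let ?h = "\<lambda>x :: real^'n. \<chi> i. if i = m then x $ m + x $ n else x $ i"
    have lin: "linear ?h" by (rule linearI) (auto simp: vec_eq_iff algebra_simps)
    have "matrix ?h = (\<chi> k. if k = m then row m (mat 1) + 1 *s row n (mat 1) else row k (mat 1))"
      using mn by (auto simp: matrix_def vec_eq_iff row_def mat_def axis_def)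
    then have det: "\<bar>det (matrix ?h)\<bar> = 1"
      using det_row_operation[OF mn, of "mat 1 :: real^'n^'n" 1] by simp
    have "measure lebesgue (?h ` cbox a b) = measure lebesgue (cbox a b)" for a b
    proof (cases "cbox a b = {}")
      case False
      \<comment> \<open>The shear formula is applied to a box whose lower corner is the origin; the
        translation by \<open>a\<close> does not change the measure.\<close>
      have box: "cbox a b = (+) a ` cbox 0 (b - a)" using cbox_translation[of a 0 "b - a"] by simp
      then have "?h ` cbox a b = (+) (?h a) ` (?h ` cbox 0 (b - a))"
        using linear_add[OF lin] by (simp only: image_image)
      moreover have "measure lebesgue (?h ` cbox 0 (b - a)) = measure lebesgue (cbox 0 (b - a))"
        using mn False box by (intro measure_shear_interval) auto
      ultimately show ?thesis unfolding box by (simp add: measure_translation del: measure_completion)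
    qed simp
    then show "?P ?h" 
      by (intro ballI lmeasurable_image_if_cbox_preserved lin det)
  qed
  then show ?thesis using assms(2) by blast
qed

section \<open>Linear control systems\<close>

lemma solution_0 [simp]: "solution A B 0 x u = x"
  by (simp add: solution_def)

lemma solution_Suc: "solution A B (Suc k) x u = A *v solution A B k x u + B *v u k"
proof -
  have "(\<Sum>i<k. (mat_power A (k - i) ** B) *v u i) = (\<Sum>i<k. A *v ((mat_power A (k - 1 - i) ** B) *v u i))"
  proof (rule sum.cong)
    fix i assume "i \<in> {..<k}"
    then have "k - i = Suc (k - 1 - i)" by auto
    then show "(mat_power A (k - i) ** B) *v u i = A *v ((mat_power A (k - 1 - i) ** B) *v u i)"
      by (simp add: matrix_vector_mul_assoc matrix_mul_assoc)
  qed simp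
  then show ?thesis
    by (simp add: solution_def matrix_vector_right_distrib matrix_vector_mult_sum
        matrix_vector_mul_assoc matrix_mul_assoc)
qed

lemma solution_split: "solution A B k x u = mat_power A k *v x + solution A B k 0 u"
  by (simp add: solution_def)

lemma solution_add: "solution A B k (x + y) u = solution A B k x u + mat_power A k *v y"
  by (simp add: solution_def matrix_vector_right_distrib)

lemma solution_cong: "(\<And>i. i < k \<Longrightarrow> u i = v i) \<Longrightarrow> solution A B k x u = solution A B k x v"
  by (simp add: solution_def)

lemma solution_combination:
  "solution A B k (a *\<^sub>R x + b *\<^sub>R y) (\<lambda>i. a *\<^sub>R u i + b *\<^sub>R v i)
    = a *\<^sub>R solution A B k x u + b *\<^sub>R solution A B k y v"
  by (induction k) (simp_all add: solution_Suc matrix_vector_right_distrib matrix_vector_mult_scaleR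
      scaleR_add_right)

lemma solution_sum:
  "solution A B k 0 (\<lambda>i. \<Sum>b\<in>I. c b *\<^sub>R g b i) = (\<Sum>b\<in>I. c b *\<^sub>R solution A B k 0 (g b))"
  by (induction k) (simp_all add: solution_Suc matrix_vector_mult_sum matrix_vector_mult_scaleR
      scaleR_add_right sum.distrib)

definition append_control :: "nat \<Rightarrow> (nat \<Rightarrow> 'u) \<Rightarrow> (nat \<Rightarrow> 'u) \<Rightarrow> nat \<Rightarrow> 'u" where
  "append_control k u v = (\<lambda>i. if i < k then u i else v (i - k))"

lemma append_in_control_seqs:
  "u \<in> control_seqs U \<Longrightarrow> v \<in> control_seqs U \<Longrightarrow> append_control k u v \<in> control_seqs U"
  by (simp add: append_control_def control_seqs_def)

lemma solution_append: "solution A B (k + l) x (append_control k u v) = solution A B l (solution A B k x u) v"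
proof (induction l)
  case 0
  show ?case using solution_cong[of k "append_control k u v" u] by (simp add: append_control_def)
next
  case (Suc l)
  then show ?case by (simp add: solution_Suc) (simp add: append_control_def)
qed

lemma solution_append_le: "j \<le> k \<Longrightarrow> solution A B j x (append_control k u v) = solution A B j x u"
  by (intro solution_cong) (simp add: append_control_def)

lemma solution_zero_control [simp]: "solution A B k 0 (\<lambda>_. 0) = 0"
  by (simp add: solution_def)

lemma solution_zero_control': "solution A B k x (\<lambda>_. 0) = mat_power A k *v x"
  by (simp add: solution_def)

lemma solution_shift:
  "solution A B (k + l) x u = solution A B l (solution A B k x u) (\<lambda>i. u (k + i))"
proof -
  have "u = append_control k u (\<lambda>i. u (k + i))" by (auto simp: append_control_def)
  then show ?thesis using solution_append by metis
qed

lemma matrix_vec_bound: "\<exists>K>0. \<forall>x. norm ((M :: real^'n^'m) *v x) \<le> norm x * K"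
  using bounded_linear.pos_bounded[OF matrix_vector_mul_bounded_linear] by blast

section \<open>The reachable set and the controllable set of the origin\<close>

locale control_system =
  fixes A :: "real^'d^'d" and B :: "real^'m^'d" and U :: "(real^'m) set"
  assumes inv: "invertible A" and convU: "convex U" and U0: "0 \<in> interior U"
    and controllable: "rank (kalman_matrix A B) = CARD('d)"
begin

definition R :: "(real^'d) set" where
  "R = {y. \<exists>k. \<exists>u\<in>control_seqs U. solution A B k 0 u = y}"

definition C :: "(real^'d) set" where
  "C = {x. \<exists>k. \<exists>u\<in>control_seqs U. solution A B k x u = 0}"

lemma zero_in_U: "0 \<in> U"
  using U0 interior_subset by blast

lemma zero_control: "(\<lambda>_. 0) \<in> control_seqs U"
  by (simp add: control_seqs_def zero_in_U)

text \<open>With unrestricted controls the states reachable from \<open>0\<close> in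
  \<open>CARD('d)\<close> steps form a subspace. It contains all columns of the Kalman matrix, which
  span the space.\<close>

lemma solution_surj: "\<exists>u. solution A B CARD('d) 0 u = x"
proof -
  let ?n = "CARD('d)"
  let ?L = "{solution A B ?n 0 u |u. True}"
  have "subspace ?L"
  proof (rule subspaceI)
    show "0 \<in> ?L" using solution_zero_control[of A B ?n] by (metis (mono_tags, lifting) mem_Collect_eq)
    show "x + y \<in> ?L" if "x \<in> ?L" "y \<in> ?L" for x y
    proof -
      obtain u v where "x = solution A B ?n 0 u" "y = solution A B ?n 0 v" using \<open>x \<in> ?L\<close> \<open>y \<in> ?L\<close> by blast
      then have "x + y = solution A B ?n 0 (\<lambda>i. 1 *\<^sub>R u i + 1 *\<^sub>R v i)"
        using solution_combination[of A B ?n 1 0 1 0 u v] by simp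
      then show ?thesis by blast
    qed
    show "c *\<^sub>R x \<in> ?L" if "x \<in> ?L" for x c
    proof -
      obtain u where "x = solution A B ?n 0 u" using \<open>x \<in> ?L\<close> by blast
      then have "c *\<^sub>R x = solution A B ?n 0 (\<lambda>i. c *\<^sub>R u i + 0 *\<^sub>R u i)"
        using solution_combination[of A B ?n c 0 0 0 u u] by simp
      then show ?thesis by blast
    qed
  qed
  moreover have "columns (kalman_matrix A B) \<subseteq> ?L"
  proof -
    have "column j (mat_power A k ** B) \<in> ?L" if "k < ?n" for k j
    proof -
      \<comment> \<open>A unit impulse at time \<open>?n - 1 - k\<close> is still propagated by the
        \<open>k\<close>-th power of \<open>A\<close>, so its effect at time \<open>?n\<close> is
        column \<open>j\<close> of that power times \<open>B\<close>.\<close>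
      let ?u = "\<lambda>i. if i = ?n - 1 - k then axis j 1 else (0 :: real^'m)"
      have eq: "column j (mat_power A k ** B) = (mat_power A k ** B) *v axis j 1"
        by (simp add: matrix_vector_mul_component vec_eq_iff column_def
            matrix_vector_mult_def axis_def if_distrib sum.delta cong: if_cong)
      have "solution A B ?n 0 ?u = (\<Sum>i<?n. (mat_power A (?n - 1 - i) ** B) *v ?u i)"
        by (simp add: solution_def)
      also have "\<dots> = (\<Sum>i\<in>{?n - 1 - k}. (mat_power A (?n - 1 - i) ** B) *v ?u i)"
        using that by (intro sum.mono_neutral_right) auto
      also have "\<dots> = (mat_power A (?n - 1 - (?n - 1 - k)) ** B) *v ?u (?n - 1 - k)"
        by (simp only: sum.insert finite.emptyI empty_iff not_False_eq_True sum.empty add_0_right)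
      also have "?n - 1 - (?n - 1 - k) = k" using that by simp
      also have "?u (?n - 1 - k) = axis j 1" by simp
      finally have "column j (mat_power A k ** B) = solution A B ?n 0 ?u" by (simp only: eq)
      then show ?thesis by blast
    qed
    then show ?thesis unfolding columns_kalman_matrix by (auto simp: columns_def)
  qed
  moreover have "span (columns (kalman_matrix A B)) = UNIV"
    using controllable by (simp add: column_rank_def flip: dim_eq_full)
  ultimately have "UNIV \<subseteq> ?L" using span_minimal by metis
  then obtain u where "x = solution A B ?n 0 u" by blast
  then show ?thesis by blast
qed

text \<open>Fixed unrestricted controls \<open>g b\<close> reach the basis vectors. Combining them
  with the coordinates of \<open>x\<close> gives a control whose size is proportional to that of
  \<open>x\<close>, hence with values in \<open>U\<close> when \<open>x\<close> is small.\<close>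

lemma small_reachable:
  "\<exists>r>0. \<forall>x. norm x < r \<longrightarrow> (\<exists>u\<in>control_seqs U. solution A B CARD('d) 0 u = x)"
proof -
  let ?n = "CARD('d)"
  obtain \<rho> where \<rho>: "\<rho> > 0" "ball 0 \<rho> \<subseteq> U" using U0 mem_interior by blast
  obtain g where g: "\<And>b. solution A B ?n 0 (g b) = (b :: real^'d)" using solution_surj by metis
  define M where "M = (\<Sum>i<?n. \<Sum>b\<in>(Basis :: (real^'d) set). norm (g b i))"
  have M: "0 \<le> M" unfolding M_def by (intro sum_nonneg) auto
  show ?thesis
  \<comment> \<open>\<open>M\<close> bounds the sum of the sizes of the basis controls at each of
    the first \<open>?n\<close> times; adding 1 keeps the denominator positive.\<close>
  proof (intro exI[of _ "\<rho> / (M + 1)"] conjI allI impI)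
    show "0 < \<rho> / (M + 1)" using \<rho> M by simp
    fix x :: "real^'d" assume "norm x < \<rho> / (M + 1)"
    then have x: "norm x * (M + 1) < \<rho>" using M by (simp add: pos_less_divide_eq)
    define u where "u = append_control ?n (\<lambda>i. \<Sum>b\<in>Basis. (x \<bullet> b) *\<^sub>R g b i) (\<lambda>_. 0)"
    have "u i \<in> U" for i
    proof (cases "i < ?n")
      case True
      have "norm (u i) \<le> (\<Sum>b\<in>Basis. \<bar>x \<bullet> b\<bar> * norm (g b i))"
        using True unfolding u_def append_control_def by (simp add: norm_sum[THEN order_trans])
      also have "\<dots> \<le> (\<Sum>b\<in>Basis. norm x * norm (g b i))"
        by (intro sum_mono mult_right_mono) (auto simp: Basis_le_norm)
      also have "\<dots> = norm x * (\<Sum>b\<in>Basis. norm (g b i))" by (simp add: sum_distrib_left)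
      also have "\<dots> \<le> norm x * M"
        unfolding M_def using True
        by (intro mult_left_mono member_le_sum[of i "{..<?n}" "\<lambda>i. \<Sum>b\<in>Basis. norm (g b i)"])
          (auto intro: sum_nonneg)
      also have "\<dots> \<le> norm x * (M + 1)" by (intro mult_left_mono) auto
      finally show ?thesis using x \<rho>(2) by auto
    next
      case False
      then show ?thesis by (simp add: u_def append_control_def zero_in_U)
    qed
    then have "u \<in> control_seqs U" by (simp add: control_seqs_def)
    moreover have "solution A B ?n 0 u = x"
      unfolding u_def solution_append_le[OF order_refl] solution_sum by (simp add: g euclidean_representation)
    ultimately show "\<exists>u\<in>control_seqs U. solution A B ?n 0 u = x" by blast
  qed
qed

text \<open>By linearity \<open>x\<close> is steered to \<open>0\<close> by a control that steers
  \<open>0\<close> to minus the free evolution of \<open>x\<close>.\<close>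

lemma small_controllable:
  "\<exists>r>0. \<forall>x. norm x < r \<longrightarrow> (\<exists>u\<in>control_seqs U. solution A B CARD('d) x u = 0)"
proof -
  let ?n = "CARD('d)"
  obtain r where r: "r > 0" "\<And>x. norm x < r \<Longrightarrow> \<exists>u\<in>control_seqs U. solution A B ?n 0 u = x"
    using small_reachable by blast
  obtain K where K: "K > 0" "\<And>x. norm (mat_power A ?n *v x) \<le> norm x * K"
    using matrix_vec_bound by blast
  show ?thesis
  proof (intro exI[of _ "r / K"] conjI allI impI)
    show "0 < r / K" using r K by simp
    fix x :: "real^'d" assume "norm x < r / K"
    then have "norm (- (mat_power A ?n *v x)) < r"
      using K(2)[of x] K(1) by (simp add: pos_less_divide_eq)
    then obtain u where "u \<in> control_seqs U" "solution A B ?n 0 u = - (mat_power A ?n *v x)"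
      using r(2) by blast
    then show "\<exists>u\<in>control_seqs U. solution A B ?n x u = 0"
      using solution_split[of A B ?n x] by (intro bexI[of _ u]) auto
  qed
qed

text \<open>The zero control keeps the origin fixed, so extra time can be spent there first. This
  gives two transfers the same length before their controls are combined convexly.\<close>

lemma R_prolong:
  assumes "u \<in> control_seqs U"
  shows "\<exists>v\<in>control_seqs U. solution A B (l + k) 0 v = solution A B k 0 u"
  using assms zero_control
  by (intro bexI[of _ "append_control l (\<lambda>_. 0) u"]) (simp_all add: solution_append append_in_control_seqs)

text \<open>Here the extra time is spent at the origin after the transfer.\<close>

lemma C_prolong:
  assumes "u \<in> control_seqs U" "solution A B k x u = 0"
  shows "\<exists>v\<in>control_seqs U. solution A B (k + l) x v = 0"
  using assms zero_control
  by (intro bexI[of _ "append_control k u (\<lambda>_. 0)"]) (simp_all add: solution_append append_in_control_seqs)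

lemma control_seqs_combination:
  assumes "u \<in> control_seqs U" "v \<in> control_seqs U" "0 \<le> a" "0 \<le> b" "a + b = 1"
  shows "(\<lambda>i. a *\<^sub>R u i + b *\<^sub>R v i) \<in> control_seqs U"
  using assms convU by (simp add: control_seqs_def convexD)

lemma convex_R: "convex R"
proof (rule convexI)
  fix x y and a b :: real
  assume "x \<in> R" "y \<in> R" and ab: "0 \<le> a" "0 \<le> b" "a + b = 1"
  then obtain k l u v where u: "u \<in> control_seqs U" "solution A B k 0 u = x"
     and v: "v \<in> control_seqs U" "solution A B l 0 v = y" unfolding R_def by blast
  obtain u' where u': "u' \<in> control_seqs U" "solution A B (l + k) 0 u' = x"
    using R_prolong[OF u(1), of l k] u(2) by auto
  obtain v' where v': "v' \<in> control_seqs U" "solution A B (l + k) 0 v' = y"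
    using R_prolong[OF v(1), of k l] v(2) by (auto simp: add.commute)
  show "a *\<^sub>R x + b *\<^sub>R y \<in> R"
    using solution_combination[of A B "l + k" a 0 b 0 u' v'] control_seqs_combination[OF u'(1) v'(1) ab]
    unfolding R_def u'(2) v'(2) by auto
qed

lemma convex_C: "convex C"
proof (rule convexI)
  fix x y and a b :: real
  assume "x \<in> C" "y \<in> C" and ab: "0 \<le> a" "0 \<le> b" "a + b = 1"
  then obtain k l u v where u: "u \<in> control_seqs U" "solution A B k x u = 0"
     and v: "v \<in> control_seqs U" "solution A B l y v = 0" unfolding C_def by blast
  obtain u' where u': "u' \<in> control_seqs U" "solution A B (k + l) x u' = 0"
    using C_prolong[OF u] by auto
  obtain v' where v': "v' \<in> control_seqs U" "solution A B (k + l) y v' = 0"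
    using C_prolong[OF v, of k] by (auto simp: add.commute)
  have "solution A B (k + l) (a *\<^sub>R x + b *\<^sub>R y) (\<lambda>i. a *\<^sub>R u' i + b *\<^sub>R v' i) = 0"
    by (simp add: solution_combination u' v')
  then show "a *\<^sub>R x + b *\<^sub>R y \<in> C"
    using control_seqs_combination[OF u'(1) v'(1) ab] unfolding C_def by blast
qed

text \<open>To hit a point \<open>z\<close> near \<open>y\<close>, the error \<open>z - y\<close> is
  pulled back \<open>k\<close> steps, reached from \<open>0\<close> by a short control, and then
  carried along while \<open>u\<close> acts.\<close>

lemma open_R: "open R"
  unfolding open_contains_ball
proof
  let ?n = "CARD('d)"
  fix y assume "y \<in> R"
  then obtain k u where u: "u \<in> control_seqs U" "solution A B k 0 u = y" unfolding R_def by blast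
  obtain r where r: "r > 0" "\<And>x. norm x < r \<Longrightarrow> \<exists>u\<in>control_seqs U. solution A B ?n 0 u = x"
    using small_reachable by blast
  obtain A' where A': "A ** A' = mat 1" using inv by (auto simp: invertible_def)
  obtain K where K: "K > 0" "\<And>x. norm (mat_power A' k *v x) \<le> norm x * K"
    using matrix_vec_bound by blast
  have "ball y (r / K) \<subseteq> R"
  proof
    fix z assume "z \<in> ball y (r / K)"
    then have "norm (z - y) * K < r"
      using K(1) by (simp add: dist_norm norm_minus_commute pos_less_divide_eq)
    then have "norm (mat_power A' k *v (z - y)) < r" using K(2)[of "z - y"] by simp
    then obtain w where w: "w \<in> control_seqs U" "solution A B ?n 0 w = mat_power A' k *v (z - y)"
      using r(2) by blast
    have "solution A B (?n + k) 0 (append_control ?n w u) = z"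
      using solution_split[of A B k "mat_power A' k *v (z - y)" u]
      by (simp add: solution_append w(2) u(2) mat_power_left_inverse_vec[OF A'])
    then show "z \<in> R" using append_in_control_seqs[OF w(1) u(1)] unfolding R_def by blast
  qed
  then show "\<exists>e>0. ball y e \<subseteq> R" using r K by (intro exI[of _ "r / K"]) simp
qed

text \<open>The control for \<open>x\<close> takes \<open>y\<close> to the free evolution of
  \<open>y - x\<close>, which is then steered to \<open>0\<close>. The radius depends on the time
  \<open>k\<close> only, not on \<open>x\<close> or \<open>u\<close>.\<close>

lemma C_uniform_nbhd:
  "\<exists>\<eta>>0. \<forall>x. \<forall>u\<in>control_seqs U. solution A B k x u = 0 \<longrightarrow>
    (\<forall>y\<in>ball x \<eta>. \<exists>v\<in>control_seqs U. solution A B (k + CARD('d)) y v = 0)"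
proof -
  let ?n = "CARD('d)"
  obtain r where r: "r > 0" "\<And>x. norm x < r \<Longrightarrow> \<exists>u\<in>control_seqs U. solution A B ?n x u = 0"
    using small_controllable by blast
  obtain K where K: "K > 0" "\<And>x. norm (mat_power A k *v x) \<le> norm x * K"
    using matrix_vec_bound by blast
  show ?thesis
  proof (intro exI[of _ "r / K"] conjI allI impI ballI)
    show "0 < r / K" using r K by simp
    fix x u y assume u: "u \<in> control_seqs U" "solution A B k x u = 0" and "y \<in> ball x (r / K)"
    then have "norm (y - x) * K < r"
      using K(1) by (simp add: dist_norm norm_minus_commute pos_less_divide_eq)
    then have "norm (mat_power A k *v (y - x)) < r" using K(2)[of "y - x"] by simp
    then obtain w where w: "w \<in> control_seqs U" "solution A B ?n (mat_power A k *v (y - x)) w = 0"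
      using r(2) by blast
    have "solution A B k y u = mat_power A k *v (y - x)"
      using solution_add[of A B k x "y - x" u] u(2) by simp
    then have "solution A B (k + ?n) y (append_control k u w) = 0" by (simp add: solution_append w(2))
    then show "\<exists>v\<in>control_seqs U. solution A B (k + ?n) y v = 0"
      using append_in_control_seqs[OF u(1) w(1)] by blast
  qed
qed

lemma C_uniform_ball:
  "\<exists>\<eta>>0. \<forall>x. \<forall>u\<in>control_seqs U. solution A B k x u = 0 \<longrightarrow> ball x \<eta> \<subseteq> C"
  using C_uniform_nbhd[of k] unfolding C_def by blast

lemma open_C: "open C"
  unfolding open_contains_ball
proof
  fix x assume "x \<in> C"
  then obtain k u where "u \<in> control_seqs U" "solution A B k x u = 0" unfolding C_def by blast
  then show "\<exists>e>0. ball x e \<subseteq> C" using C_uniform_ball[of k] by blast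
qed

lemma zero_in_R: "0 \<in> R" and zero_in_C: "0 \<in> C"
proof -
  have "solution A B 0 0 (\<lambda>_. 0) = (0 :: real^'d)" by simp
  then show "0 \<in> R" "0 \<in> C" unfolding R_def C_def using zero_control by blast+
qed

text \<open>The sets controllable within a given time increase with it, and each lies in the
  interior of a later one. Compactness thus yields a single time.\<close>

lemma C_uniform_time:
  assumes "compact K" "K \<subseteq> C"
  shows "\<exists>n. \<forall>x\<in>K. \<exists>u\<in>control_seqs U. solution A B n x u = 0"
proof -
  define S where "S n = {x. \<exists>u\<in>control_seqs U. solution A B n x u = 0}" for n
  have mono: "S k \<subseteq> S (k + l)" for k l
    unfolding S_def using C_prolong by blast
  have cover: "x \<in> (\<Union>n. interior (S n))" if "x \<in> K" for x
  proof -
    obtain k u where u: "u \<in> control_seqs U" "solution A B k x u = 0"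
      using \<open>x \<in> K\<close> assms(2) unfolding C_def by blast
    then obtain \<eta> where "\<eta> > 0" "ball x \<eta> \<subseteq> S (k + CARD('d))"
      using C_uniform_nbhd[of k] unfolding S_def by blast
    then show ?thesis using mem_interior by blast
  qed
  obtain F where F: "finite F" "K \<subseteq> (\<Union>n\<in>F. interior (S n))"
    by (rule compactE_image[OF assms(1), of UNIV "\<lambda>n. interior (S n)"]) (use cover in auto)
  have "x \<in> S (Max F)" if x: "x \<in> K" for x
  proof -
    obtain n where n: "n \<in> F" "x \<in> S n" using F(2) x interior_subset by blast
    then have "n \<le> Max F" using F(1) by simp
    then show ?thesis using mono[of n "Max F - n"] n(2) by auto
  qed
  then show ?thesis unfolding S_def by blast
qed

text \<open>The path goes from \<open>x\<close> to \<open>0\<close> in a common time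
  \<open>n\<close>, from \<open>0\<close> to \<open>x0\<close> in \<open>m\<close> steps, and rests
  there. The margin \<eta> is uniform on the first leg because every state there is controllable in
  time \<open>n\<close>, and on the second because it consists of finitely many points of the open
  set \<open>C\<close>.\<close>

lemma steer_to_equilibrium:
  assumes K: "compact K" "K \<subseteq> C" and x0: "x0 \<in> R" "x0 \<in> C" "A *v x0 + B *v u0 = x0" "u0 \<in> U"
  shows "\<exists>\<eta>>0. \<exists>N. \<forall>x\<in>K. \<exists>u\<in>control_seqs U.
    (\<forall>k. ball (solution A B k x u) \<eta> \<subseteq> C) \<and> (\<forall>i\<ge>N. u i = u0)"
proof -
  obtain n where n: "\<And>x. x \<in> K \<Longrightarrow> \<exists>u\<in>control_seqs U. solution A B n x u = 0"
    using C_uniform_time[OF K] by blast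
  obtain \<eta>1 where \<eta>1: "\<eta>1 > 0"
      "\<And>x u. u \<in> control_seqs U \<Longrightarrow> solution A B n x u = 0 \<Longrightarrow> ball x \<eta>1 \<subseteq> C"
    using C_uniform_ball[of n] by blast
  obtain m v where v: "v \<in> control_seqs U" "solution A B m 0 v = x0"
    using x0(1) unfolding R_def by blast
  have "(\<lambda>j. solution A B j 0 v) ` {..m} \<subseteq> C"
  proof clarify
    fix j assume "j \<le> m"
    \<comment> \<open>States on the way to \<open>x0\<close> can reach \<open>x0\<close>, which lies
      in \<open>C\<close>; so they lie in \<open>C\<close> themselves.\<close>
    then have "solution A B (m - j) (solution A B j 0 v) (\<lambda>i. v (j + i)) = x0"
      using solution_shift[of A B j "m - j" 0 v] v(2) by simp
    moreover obtain k w where w: "w \<in> control_seqs U" "solution A B k x0 w = 0"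
      using x0(2) unfolding C_def by blast
    ultimately have "solution A B ((m - j) + k) (solution A B j 0 v) (append_control (m - j) (\<lambda>i. v (j + i)) w) = 0"
      by (simp add: solution_append)
    moreover have "append_control (m - j) (\<lambda>i. v (j + i)) w \<in> control_seqs U"
      using v(1) w(1) by (intro append_in_control_seqs) (auto simp: control_seqs_def)
    ultimately show "solution A B j 0 v \<in> C" unfolding C_def by blast
  qed
  moreover have "compact ((\<lambda>j. solution A B j 0 v) ` {..m})"
    by (intro finite_imp_compact) simp
  ultimately obtain \<eta>2 where "\<eta>2 > 0" "(\<Union>y\<in>(\<lambda>j. solution A B j 0 v) ` {..m}. ball y \<eta>2) \<subseteq> C"
    using compact_subset_open_imp_ball_epsilon_subset[OF _ open_C] by blast
  then have \<eta>2: "\<eta>2 > 0" "\<And>j. j \<le> m \<Longrightarrow> ball (solution A B j 0 v) \<eta>2 \<subseteq> C"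
    by blast+
  have stay: "solution A B k x0 (\<lambda>_. u0) = x0" for k
    by (induction k) (simp_all add: solution_Suc x0(3))
  show ?thesis
  proof (intro exI[of _ "min \<eta>1 \<eta>2"] exI[of _ "n + m"] conjI ballI)
    show "0 < min \<eta>1 \<eta>2" using \<eta>1 \<eta>2 by simp
    fix x assume "x \<in> K"
    then obtain w where w: "w \<in> control_seqs U" "solution A B n x w = 0" using n by blast
    define u where "u = append_control n w (append_control m v (\<lambda>_. u0))"
    have "u \<in> control_seqs U"
      unfolding u_def using w v x0(4) by (intro append_in_control_seqs) (auto simp: control_seqs_def)
    moreover have "ball (solution A B k x u) (min \<eta>1 \<eta>2) \<subseteq> C" for k
    proof (cases "k \<le> n")
      case True
      have "solution A B (n - k) (solution A B k x w) (\<lambda>i. w (k + i)) = 0"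
        using solution_shift[of A B k "n - k" x w] True w(2) by simp
      moreover have "(\<lambda>i. w (k + i)) \<in> control_seqs U" using w(1) by (simp add: control_seqs_def)
      \<comment> \<open>The remaining \<open>n - k\<close> steps are padded by \<open>k\<close>
        steps at \<open>0\<close>, so that the same time \<open>n\<close> and hence the same radius
        \<open>\<eta>1\<close> serve for every \<open>k\<close>.\<close>
      ultimately obtain w' where "w' \<in> control_seqs U" "solution A B n (solution A B k x w) w' = 0"
        using C_prolong[of _ "n - k" _ k] True by auto
      then have "ball (solution A B k x w) \<eta>1 \<subseteq> C" using \<eta>1 by blast
      then show ?thesis using True by (auto simp: u_def solution_append_le)
    next
      case False
      have "solution A B (n + (k - n)) x u = solution A B (k - n) 0 (append_control m v (\<lambda>_. u0))"
        unfolding u_def solution_append w(2) ..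
      moreover have "\<exists>j\<le>m. solution A B (k - n) 0 (append_control m v (\<lambda>_. u0)) = solution A B j 0 v"
      proof (cases "k - n \<le> m")
        case True
        then show ?thesis by (auto simp: solution_append_le)
      next
        case False
        then have "solution A B (m + (k - n - m)) 0 (append_control m v (\<lambda>_. u0)) = x0"
          unfolding solution_append v(2) stay by simp
        then show ?thesis using v(2) False by (intro exI[of _ m]) simp
      qed
      ultimately obtain j where "j \<le> m" "solution A B k x u = solution A B j 0 v" using False by auto
      then show ?thesis using \<eta>2(2)[of j] by auto
    qed
    moreover have "\<forall>i\<ge>n + m. u i = u0" by (auto simp: u_def append_control_def)
    ultimately show "\<exists>u\<in>control_seqs U.
        (\<forall>k. ball (solution A B k x u) (min \<eta>1 \<eta>2) \<subseteq> C) \<and> (\<forall>i\<ge>n + m. u i = u0)" by blast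
  qed
qed

end

section \<open>The control set\<close>

locale hyperbolic_control_system = control_system A B U + hyperbolic_iso A
  for A :: "real^'d^'d" and B :: "real^'m^'d" and U
begin

text \<open>Backward iteration makes an unstable vector small enough to be reached by a short
  control; the zero control then expands it back to \<open>e\<close>.\<close>

lemma Eu_subset_R: "Eu \<subseteq> R"
proof
  fix e assume "e \<in> Eu"
  then have lim: "(\<lambda>k. mat_power A' k *v e) \<longlonglongrightarrow> 0" by (simp add: Eu_def stable_set_def)
  obtain r where r: "r > 0" "\<And>x. norm x < r \<Longrightarrow> \<exists>u\<in>control_seqs U. solution A B CARD('d) 0 u = x"
    using small_reachable by blast
  obtain k where "norm (mat_power A' k *v e) < r" using LIMSEQ_D[OF lim r(1)] by auto
  then obtain u where u: "u \<in> control_seqs U" "solution A B CARD('d) 0 u = mat_power A' k *v e"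
    using r(2) by blast
  have "solution A B (CARD('d) + k) 0 (append_control CARD('d) u (\<lambda>_. 0)) = e"
    by (simp add: solution_append u(2) solution_zero_control' mat_power_left_inverse_vec[OF AA'])
  then show "e \<in> R" unfolding R_def using append_in_control_seqs[OF u(1) zero_control] by blast
qed

text \<open>The zero control contracts \<open>e\<close> until it can be steered to
  \<open>0\<close>.\<close>

lemma Es_subset_C: "Es \<subseteq> C"
proof
  fix e assume "e \<in> Es"
  then have lim: "(\<lambda>k. mat_power A k *v e) \<longlonglongrightarrow> 0" by (simp add: Es_def stable_set_def)
  obtain r where r: "r > 0" "\<And>x. norm x < r \<Longrightarrow> \<exists>u\<in>control_seqs U. solution A B CARD('d) x u = 0"
    using small_controllable by blast
  obtain k where "norm (mat_power A k *v e) < r" using LIMSEQ_D[OF lim r(1)] by auto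
  then obtain u where u: "u \<in> control_seqs U" "solution A B CARD('d) (mat_power A k *v e) u = 0"
    using r(2) by blast
  have "solution A B (k + CARD('d)) e (append_control k (\<lambda>_. 0) u) = 0"
    by (simp add: solution_append u(2) solution_zero_control')
  then show "e \<in> C" unfolding C_def using append_in_control_seqs[OF zero_control u(1)] by blast
qed

lemma R_plus_Eu: "x \<in> R \<Longrightarrow> e \<in> Eu \<Longrightarrow> x + e \<in> R"
  using open_convex_plus_subspace[OF open_R convex_R subspace_Eu Eu_subset_R] .

lemma C_plus_Es: "x \<in> C \<Longrightarrow> e \<in> Es \<Longrightarrow> x + e \<in> C"
  using open_convex_plus_subspace[OF open_C convex_C subspace_Es Es_subset_C] .

lemma solution_in_C_imp:
  assumes "u \<in> control_seqs U" "solution A B k x u \<in> C"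
  shows "x \<in> C"
proof -
  obtain l v where v: "v \<in> control_seqs U" "solution A B l (solution A B k x u) v = 0"
    using assms(2) unfolding C_def by blast
  then have "solution A B (k + l) x (append_control k u v) = 0" by (simp add: solution_append)
  then show ?thesis unfolding C_def using append_in_control_seqs[OF assms(1) v(1)] by blast
qed

lemma solution_in_R:
  assumes "u \<in> control_seqs U" "x \<in> R"
  shows "solution A B k x u \<in> R"
proof -
  obtain l v where v: "v \<in> control_seqs U" "solution A B l 0 v = x"
    using assms(2) unfolding R_def by blast
  then have "solution A B (l + k) 0 (append_control l v u) = solution A B k x u" by (simp add: solution_append)
  then show ?thesis unfolding R_def using append_in_control_seqs[OF v(1) assms(1)] by blast
qed

lemma solution_in_closure_R:
  assumes "u \<in> control_seqs U" "x \<in> closure R"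
  shows "solution A B k x u \<in> closure R"
proof -
  obtain s where s: "\<And>n. s n \<in> R" "s \<longlonglongrightarrow> x" using assms(2) closure_sequential by blast
  have "(\<lambda>n. mat_power A k *v s n + solution A B k 0 u) \<longlonglongrightarrow> mat_power A k *v x + solution A B k 0 u"
    using s(2) by (intro tendsto_intros bounded_linear.tendsto[OF matrix_vector_mul_bounded_linear])
  then have "(\<lambda>n. solution A B k (s n) u) \<longlonglongrightarrow> solution A B k x u"
    by (simp only: solution_split[symmetric])
  then show ?thesis
    unfolding closure_sequential using solution_in_R[OF assms(1) s(1)]
    by (intro exI[of _ "\<lambda>n. solution A B k (s n) u"]) simp
qed

lemma norm_stable_le: "norm (mat_power A k *v ps x) \<le> onorm (\<lambda>x. mat_power A k *v ps x) * norm x"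
  and norm_unstable_le: "norm (mat_power A' k *v pu x) \<le> onorm (\<lambda>x. mat_power A' k *v pu x) * norm x"
  using onorm[of "\<lambda>x. mat_power A k *v ps x" x] onorm[of "\<lambda>x. mat_power A' k *v pu x" x]
    linear_compose[OF linear_ps matrix_vector_mul_linear, of "mat_power A k", unfolded o_def]
    linear_compose[OF linear_pu matrix_vector_mul_linear, of "mat_power A' k", unfolded o_def]
  by (simp_all add: linear_conv_bounded_linear)

lemma onorm_stable_nonneg: "0 \<le> onorm (\<lambda>x. mat_power A k *v ps x)"
  and onorm_unstable_nonneg: "0 \<le> onorm (\<lambda>x. mat_power A' k *v pu x)"
  using onorm_pos_le[of "\<lambda>x. mat_power A k *v ps x"] onorm_pos_le[of "\<lambda>x. mat_power A' k *v pu x"]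
    linear_compose[OF linear_ps matrix_vector_mul_linear, of "mat_power A k", unfolded o_def]
    linear_compose[OF linear_pu matrix_vector_mul_linear, of "mat_power A' k", unfolded o_def]
  by (simp_all add: linear_conv_bounded_linear)

lemma A'_unstable_lim: "(\<lambda>k. mat_power A' k *v pu x) \<longlonglongrightarrow> 0"
  using pu_in[of x] by (simp add: Eu_def stable_set_def)

lemma A_stable_lim: "(\<lambda>k. mat_power A k *v ps x) \<longlonglongrightarrow> 0"
  using ps_in[of x] by (simp add: Es_def stable_set_def)

text \<open>The correction of the initial value removes the unstable component of the endpoint. What
  remains lies in \<open>Es\<close> and therefore in \<open>C\<close>.\<close>

lemma pull_back_in_C:
  assumes "u \<in> control_seqs U"
  shows "x - mat_power A' k *v pu (solution A B k x u) \<in> C"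
proof (rule solution_in_C_imp[OF assms])
  let ?y = "solution A B k x u"
  have "?y = solution A B k (x - mat_power A' k *v pu ?y) u + pu ?y"
    using solution_add[of A B k "x - mat_power A' k *v pu ?y" "mat_power A' k *v pu ?y" u]
    by (simp add: mat_power_left_inverse_vec[OF AA'])
  then have "solution A B k (x - mat_power A' k *v pu ?y) u = ps ?y"
    by (simp add: ps_def eq_diff_eq)
  then show "solution A B k (x - mat_power A' k *v pu ?y) u \<in> C"
    using Es_subset_C ps_in by auto
qed

text \<open>Without the contribution of the stable part of \<open>x\<close>, the endpoint is a state
  reachable from \<open>0\<close> plus an unstable vector.\<close>

lemma push_forward_in_R:
  assumes "u \<in> control_seqs U"
  shows "solution A B k x u - mat_power A k *v ps x \<in> R"
proof -
  have "solution A B k x u - mat_power A k *v ps x = solution A B k 0 u + mat_power A k *v pu x"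
    using solution_split[of A B k x u]
    by (simp add: ps_def matrix_vector_mult_diff_distrib)
  moreover have "solution A B k 0 u \<in> R" using solution_in_R[OF assms zero_in_R] .
  ultimately show ?thesis using R_plus_Eu mat_power_Eu pu_in by metis
qed

text \<open>Along return times tending to infinity, the corrections in
  \<open>push_forward_in_R\<close> and \<open>pull_back_in_C\<close> become arbitrarily
  small.\<close>

lemma recurrent_in_closures:
  assumes rec: "\<And>n e. e > 0 \<Longrightarrow> \<exists>k\<ge>n. \<exists>u\<in>control_seqs U. dist (solution A B k x u) x < e"
  shows "x \<in> closure R" "x \<in> closure C"
proof -
  show "x \<in> closure R" unfolding closure_approachable
  proof (intro allI impI)
    fix e :: real assume "e > 0"
    obtain n where n: "\<And>k. k \<ge> n \<Longrightarrow> norm (mat_power A k *v ps x) < e / 2"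
      using LIMSEQ_D[OF A_stable_lim[of x], of "e/2"] \<open>e > 0\<close> by auto
    obtain k u where k: "k \<ge> n" "u \<in> control_seqs U" "dist (solution A B k x u) x < e / 2"
      using rec[of "e/2" n] \<open>e > 0\<close> by auto
    have "dist (solution A B k x u - mat_power A k *v ps x) x < e"
      using k(3) n[OF k(1)] norm_triangle_ineq4[of "solution A B k x u - x" "mat_power A k *v ps x"]
      by (simp add: dist_norm algebra_simps)
    then show "\<exists>y\<in>R. dist y x < e" using push_forward_in_R[OF k(2)] by blast
  qed
  show "x \<in> closure C" unfolding closure_approachable
  proof (intro allI impI)
    fix e :: real assume "e > 0"
    \<comment> \<open>The vector pulled back is the endpoint, which varies with \<open>k\<close>.
      Decay of operator norms is therefore used, with the bound \<open>norm x + 1\<close> for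
      returns within distance 1.\<close>
    have "(\<lambda>k. onorm (\<lambda>x. mat_power A' k *v pu x)) \<longlonglongrightarrow> 0"
      using summable_unstable summable_LIMSEQ_zero by blast
    then have "(\<lambda>k. onorm (\<lambda>x. mat_power A' k *v pu x) * (norm x + 1)) \<longlonglongrightarrow> 0"
      by (rule tendsto_mult_left_zero)
    then have "\<forall>\<^sub>F k in sequentially. onorm (\<lambda>x. mat_power A' k *v pu x) * (norm x + 1) < e"
      using \<open>e > 0\<close> by (rule order_tendstoD)
    then obtain n where n: "\<And>k. k \<ge> n \<Longrightarrow> onorm (\<lambda>x. mat_power A' k *v pu x) * (norm x + 1) < e"
      unfolding eventually_sequentially by blast
    obtain k u where k: "k \<ge> n" "u \<in> control_seqs U" "dist (solution A B k x u) x < 1"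
      using rec[of 1 n] by auto
    let ?y = "solution A B k x u"
    have "norm ?y \<le> norm x + 1"
      using k(3) norm_triangle_ineq2[of ?y x] by (simp add: dist_norm)
    then have "onorm (\<lambda>x. mat_power A' k *v pu x) * norm ?y \<le> onorm (\<lambda>x. mat_power A' k *v pu x) * (norm x + 1)"
      by (intro mult_left_mono onorm_unstable_nonneg)
    then have "norm (mat_power A' k *v pu ?y) < e"
      using norm_unstable_le[of k ?y] n[OF k(1)] by linarith
    then have "dist (x - mat_power A' k *v pu ?y) x < e" by (simp add: dist_norm)
    then show "\<exists>y\<in>C. dist y x < e" using pull_back_in_C[OF k(2)] by blast
  qed
qed

text \<open>The number 1 is not an eigenvalue: for a fixed vector the stable part has a constant
  forward orbit and the unstable part a constant backward orbit, and both orbits tend to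
  \<open>0\<close>. So \<open>mat 1 - A\<close> is invertible.\<close>

lemma equilibrium_exists: "\<exists>x. A *v x + B *v u = x"
proof -
  have "x = 0" if "(mat 1 - A) *v x = 0" for x
  proof -
    have "A *v x = x" using that by (simp add: matrix_vector_mult_diff_rdistrib)
    then have fix_x: "mat_power A k *v x = x" for k
      by (induction k) (simp_all add: mat_power_Suc_vec' del: mat_power.simps(2))
    have "A *v ps x = ps x" "A *v pu x = pu x"
      using pu_A[of x] \<open>A *v x = x\<close> by (auto simp: ps_def matrix_vector_mult_diff_distrib)
    then have "mat_power A k *v ps x = ps x" "mat_power A' k *v pu x = pu x" for k
      using mat_power_left_inverse_vec[OF A'A, of k "pu x"] pu_mat_power[of k x] ps_mat_power[of k x]
      by (simp_all add: fix_x)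
    then have "ps x = 0" "pu x = 0"
      using A_stable_lim[of x] A'_unstable_lim[of x] by (simp_all add: LIMSEQ_const_iff)
    then show "x = 0" using pu_plus_ps[of x] by simp
  qed
  then have "\<exists>N. N ** (mat 1 - A) = mat 1"
    by (subst matrix_left_invertible_ker) blast
  then obtain N where "(mat 1 - A) ** N = mat 1"
    using matrix_left_right_inverse by blast
  then have "(mat 1 - A) *v (N *v (B *v u)) = B *v u"
    by (metis matrix_vector_mul_assoc matrix_vector_mul_lid)
  then have "A *v (N *v (B *v u)) + B *v u = N *v (B *v u)"
    by (simp add: matrix_vector_mult_diff_rdistrib algebra_simps)
  then show ?thesis by blast
qed

lemma equilibrium_in_closures:
  assumes "A *v x + B *v u = x" "u \<in> U"
  shows "x \<in> closure R" "x \<in> closure C"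
proof -
  have "solution A B k x (\<lambda>_. u) = x" for k
    by (induction k) (simp_all add: solution_Suc assms(1))
  moreover have "(\<lambda>_. u) \<in> control_seqs U" using assms(2) by (simp add: control_seqs_def)
  ultimately have "\<exists>k\<ge>n. \<exists>u\<in>control_seqs U. dist (solution A B k x u) x < e" if "e > 0" for n e
    using that by (intro exI[of _ n] conjI bexI[of _ "\<lambda>_. u"]) auto
  then show "x \<in> closure R" "x \<in> closure C" using recurrent_in_closures by blast+
qed

text \<open>Equilibria themselves are only known to lie in the closures. Moving them towards
  \<open>0\<close>, an interior point of both convex sets, puts them inside, and
  \<open>(1 - s) x\<close> is the equilibrium for \<open>(1 - s) u\<close>.\<close>

lemma shrunk_equilibrium:
  assumes "A *v x + B *v u = x" "u \<in> U" "0 < s" "s \<le> 1"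
  shows "(1 - s) *\<^sub>R x \<in> R" "(1 - s) *\<^sub>R x \<in> C"
proof -
  have "x - s *\<^sub>R (x - 0) \<in> interior R"
    by (intro mem_interior_closure_convex_shrink convex_R equilibrium_in_closures(1)[OF assms(1,2)] assms(3,4))
      (simp add: interior_open open_R zero_in_R)
  moreover have "x - s *\<^sub>R (x - 0) \<in> interior C"
    by (intro mem_interior_closure_convex_shrink convex_C equilibrium_in_closures(2)[OF assms(1,2)] assms(3,4))
      (simp add: interior_open open_C zero_in_C)
  ultimately show "(1 - s) *\<^sub>R x \<in> R" "(1 - s) *\<^sub>R x \<in> C"
    using open_R open_C by (simp_all add: interior_open algebra_simps)
qed

text \<open>A return close to \<open>x\<close> ends in \<open>D\<close> again, so another return can
  be appended. Each takes at least one step, which makes the total time arbitrarily large.\<close>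

lemma interior_recurrent:
  assumes "control_set_props A B U D" "x \<in> interior D" "e > 0"
  shows "\<exists>k\<ge>n. \<exists>u\<in>control_seqs U. dist (solution A B k x u) x < e"
proof -
  have xD: "x \<in> D" using assms(2) interior_subset by blast
  have reach: "\<exists>k\<ge>1. \<exists>u\<in>control_seqs U. dist (solution A B k y u) x < e'" if "y \<in> D" "e' > 0" for y e'
  proof -
    have "x \<in> closure (reachable_set A B U y)"
      using assms(1) that xD unfolding control_set_props_def by blast
    then obtain z where "z \<in> reachable_set A B U y" "dist z x < e'"
      using \<open>e' > 0\<close> unfolding closure_approachable by blast
    then show ?thesis unfolding reachable_set_def by blast
  qed
  obtain r where r: "r > 0" "ball x r \<subseteq> D" using assms(2) mem_interior by blast
  \<comment> \<open>Tolerance \<open>min e r\<close> instead of \<open>e\<close> keeps the endpoint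
    in the ball inside \<open>D\<close>, from which the next return starts.\<close>
  have "\<exists>k\<ge>n. \<exists>u\<in>control_seqs U. dist (solution A B k x u) x < min e r" for n
  proof (induction n)
    case 0
    then show ?case using reach[OF xD, of "min e r"] assms(3) r(1) by auto
  next
    case (Suc n)
    then obtain k u where k: "k \<ge> n" "u \<in> control_seqs U" "dist (solution A B k x u) x < min e r" by blast
    then have "solution A B k x u \<in> D" using r(2) by (auto simp: dist_commute)
    then obtain l v where l: "l \<ge> 1" "v \<in> control_seqs U"
        "dist (solution A B l (solution A B k x u) v) x < min e r"
      using reach[of "solution A B k x u" "min e r"] assms(3) r(1) by auto
    then show ?case using k append_in_control_seqs[OF k(2) l(2)]
      by (intro exI[of _ "k + l"] conjI bexI[of _ "append_control k u v"]) (auto simp: solution_append)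
  qed
  then show ?thesis by (meson min_less_iff_conj)
qed

section \<open>Identification of the control set\<close>

lemma reachable_set_closure_le:
  assumes "x \<in> closure R"
  shows "closure (reachable_set A B U x) \<subseteq> closure R"
  using solution_in_closure_R[OF _ assms] unfolding reachable_set_def
  by (intro closure_minimal) auto

text \<open>An interior point \<open>p\<close> lies in the interior of \<open>closure C\<close>,
  which is \<open>C\<close> by convexity and openness. Any other \<open>x\<close> in
  \<open>D\<close> is approximated from \<open>p\<close>, hence lies in \<open>closure R\<close>,
  and can be steered into the open set \<open>C\<close> around \<open>p\<close>, hence lies in
  \<open>C\<close>.\<close>

lemma control_set_subset:
  assumes "control_set_props A B U D" "interior D \<noteq> {}"
  shows "D \<subseteq> closure R \<inter> C"
proof -
  have int: "x \<in> closure R \<and> x \<in> closure C" if "x \<in> interior D" for x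
    using recurrent_in_closures[OF interior_recurrent[OF assms(1) that]] by blast
  obtain p where p: "p \<in> interior D" using assms(2) by blast
  have "interior D \<subseteq> interior (closure C)" using int by (intro interior_maximal) auto
  also have "\<dots> = C" using convex_interior_closure[OF convex_C] open_C by (simp add: interior_open)
  finally have pC: "p \<in> C" using p by blast
  have pD: "p \<in> D" using p interior_subset by blast
  show ?thesis
  proof
    fix x assume x: "x \<in> D"
    have "x \<in> closure (reachable_set A B U p)" "p \<in> closure (reachable_set A B U x)"
      using assms(1) x pD unfolding control_set_props_def by blast+
    then have "x \<in> closure R" using int[OF p] reachable_set_closure_le by blast
    moreover have "reachable_set A B U x \<inter> C \<noteq> {}"
      using \<open>p \<in> closure (reachable_set A B U x)\<close> pC open_C closure_iff_nhds_not_empty by blast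
    then have "x \<in> C" using solution_in_C_imp unfolding reachable_set_def by blast
    ultimately show "x \<in> closure R \<inter> C" by blast
  qed
qed

text \<open>From a point of \<open>C\<close> all of \<open>R\<close> is reached via
  \<open>0\<close>. The orbit that goes to \<open>0\<close> and rests there stays in
  \<open>C\<close>, since each of its states can reach \<open>0\<close>, and in
  \<open>closure R\<close> by forward invariance.\<close>

lemma control_set_props_closure_R_Int_C: "control_set_props A B U (closure R \<inter> C)"
  unfolding control_set_props_def
proof (intro conjI ballI)
  fix x assume x: "x \<in> closure R \<inter> C"
  then obtain k u where u: "u \<in> control_seqs U" "solution A B k x u = 0" unfolding C_def by blast
  have "y \<in> reachable_set A B U x" if "y \<in> R" for y
  proof -
    obtain l v where v: "v \<in> control_seqs U" "solution A B l 0 v = y"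
      using \<open>y \<in> R\<close> unfolding R_def by blast
    \<comment> \<open>The extra step guarantees a positive total time, as
      \<open>reachable_set\<close> demands, even for \<open>k = l = 0\<close>.\<close>
    obtain v' where v': "v' \<in> control_seqs U" "solution A B (1 + l) 0 v' = y"
      using R_prolong[OF v(1), of 1 l] v(2) by auto
    have "solution A B (k + (1 + l)) x (append_control k u v') = y" by (simp only: solution_append u(2) v'(2))
    moreover have "k + (1 + l) \<ge> 1" by simp
    ultimately show ?thesis
      using append_in_control_seqs[OF u(1) v'(1)] unfolding reachable_set_def by blast
  qed
  then show "closure R \<inter> C \<subseteq> closure (reachable_set A B U x)"
    using closure_mono[of R "reachable_set A B U x"] by blast
  define w where "w = append_control k u (\<lambda>_. 0)"
  have w: "w \<in> control_seqs U" unfolding w_def by (rule append_in_control_seqs[OF u(1) zero_control])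
  have "solution A B j x w \<in> C" for j
  proof (cases "j \<le> k")
    case True
    then have "solution A B (k - j) (solution A B j x u) (\<lambda>i. u (j + i)) = 0"
      using solution_shift[of A B j "k - j" x u] u(2) by simp
    moreover have "(\<lambda>i. u (j + i)) \<in> control_seqs U" using u(1) by (simp add: control_seqs_def)
    ultimately have "solution A B j x u \<in> C" unfolding C_def by blast
    then show ?thesis using True by (simp add: w_def solution_append_le)
  next
    case False
    then have "solution A B (k + (j - k)) x w = 0" unfolding w_def solution_append u(2) by simp
    then show ?thesis using False zero_in_C by simp
  qed
  then show "\<exists>u\<in>control_seqs U. \<forall>k\<ge>1. solution A B k x u \<in> closure R \<inter> C"
    using w solution_in_closure_R[OF w] x by blast
qed

theorem control_set_eq:
  assumes "is_control_set A B U D" "interior D \<noteq> {}"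
  shows "D = closure R \<inter> C"
  using assms control_set_subset control_set_props_closure_R_Int_C unfolding is_control_set_def by blast

section \<open>Boundedness of the control set\<close>

lemma ps_solution: "ps (solution A B k 0 u) = (\<Sum>i<k. mat_power A (k - 1 - i) *v ps (B *v u i))"
  using linear_ps by (simp add: solution_def linear_sum ps_mat_power flip: matrix_vector_mul_assoc)

text \<open>Variation of constants seen from time 0: the inputs are multiplied by negative powers of
  \<open>A\<close> on \<open>Eu\<close>, whose norms are summable.\<close>

lemma pu_solution_pullback:
  "mat_power A' k *v pu (solution A B k x u) = pu x + (\<Sum>i<k. mat_power A' (Suc i) *v pu (B *v u i))"
proof (induction k)
  case (Suc k)
  have "mat_power A' (Suc k) *v pu (solution A B (Suc k) x u)
      = mat_power A' k *v pu (solution A B k x u) + mat_power A' (Suc k) *v pu (B *v u k)"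
    using linear_pu
    by (simp add: solution_Suc linear_add matrix_vector_right_distrib pu_A A'A_vec mat_power_Suc_vec'
        del: mat_power.simps)
  then show ?case using Suc by simp
qed simp

text \<open>The stable part of a reachable state is a sum of bounded inputs weighted by maps with
  summable norms. The resulting bound does not depend on the time and passes to the closure.\<close>

lemma bounded_ps_closure_R:
  assumes "bounded U"
  shows "\<exists>c. \<forall>x\<in>closure R. norm (ps x) \<le> c"
proof -
  obtain b where b: "\<And>v. v \<in> U \<Longrightarrow> norm v \<le> b" using assms by (auto simp: bounded_iff)
  obtain K where K: "K > 0" "\<And>v. norm (B *v v) \<le> norm v * K" using matrix_vec_bound by blast
  let ?a = "\<lambda>k. onorm (\<lambda>x. mat_power A k *v ps x)"
  have bK: "norm (B *v v) \<le> b * K" if "v \<in> U" for v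
    using K(2)[of v] mult_right_mono[OF b[OF that], of K] K(1) by linarith
  have "norm (ps y) \<le> suminf ?a * (b * K)" if "y \<in> R" for y
  proof -
    obtain k u where u: "u \<in> control_seqs U" "solution A B k 0 u = y"
      using \<open>y \<in> R\<close> unfolding R_def by blast
    have uU: "u i \<in> U" for i using u(1) by (simp add: control_seqs_def)
    have "norm (ps y) \<le> (\<Sum>i<k. norm (mat_power A (k - 1 - i) *v ps (B *v u i)))"
      unfolding u(2)[symmetric] ps_solution by (rule norm_sum)
    also have "\<dots> \<le> (\<Sum>i<k. ?a (k - 1 - i) * (b * K))"
      by (intro sum_mono order_trans[OF norm_stable_le] mult_left_mono bK uU onorm_stable_nonneg)
    also have "\<dots> = (\<Sum>i<k. ?a i) * (b * K)"
      using sum.nat_diff_reindex[of "\<lambda>i. ?a i * (b * K)" k] by (simp add: sum_distrib_right)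
    also have "\<dots> \<le> suminf ?a * (b * K)"
      using bK[OF zero_in_U] summable_stable onorm_stable_nonneg
      by (intro mult_right_mono sum_le_suminf) (auto)
    finally show ?thesis .
  qed
  then have "R \<subseteq> {x. norm (ps x) \<le> suminf ?a * (b * K)}" by blast
  moreover have "closed {x. norm (ps x) \<le> suminf ?a * (b * K)}"
    using linear_ps by (intro closed_Collect_le continuous_intros linear_continuous_on)
      (simp_all add: linear_conv_bounded_linear)
  ultimately have "closure R \<subseteq> {x. norm (ps x) \<le> suminf ?a * (b * K)}"
    by (rule closure_minimal)
  then show ?thesis by blast
qed

lemma bounded_pu_C:
  assumes "bounded U"
  shows "\<exists>c. \<forall>x\<in>C. norm (pu x) \<le> c"
proof -
  obtain b where b: "\<And>v. v \<in> U \<Longrightarrow> norm v \<le> b" using assms by (auto simp: bounded_iff)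
  obtain K where K: "K > 0" "\<And>v. norm (B *v v) \<le> norm v * K" using matrix_vec_bound by blast
  let ?a = "\<lambda>k. onorm (\<lambda>x. mat_power A' k *v pu x)"
  have bK: "norm (B *v v) \<le> b * K" if "v \<in> U" for v
    using K(2)[of v] mult_right_mono[OF b[OF that], of K] K(1) by linarith
  have "norm (pu x) \<le> (\<Sum>i. ?a (Suc i)) * (b * K)" if "x \<in> C" for x
  proof -
    obtain k u where u: "u \<in> control_seqs U" "solution A B k x u = 0"
      using \<open>x \<in> C\<close> unfolding C_def by blast
    have uU: "u i \<in> U" for i using u(1) by (simp add: control_seqs_def)
    \<comment> \<open>Since the final state is \<open>0\<close>, the pullback formula expresses
      \<open>pu x\<close> by the inputs alone.\<close>
    have "pu x = - (\<Sum>i<k. mat_power A' (Suc i) *v pu (B *v u i))"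
      using pu_solution_pullback[of k x u] linear_0[OF linear_pu] u(2)
      by (simp add: eq_neg_iff_add_eq_0 del: mat_power.simps)
    then have "norm (pu x) \<le> (\<Sum>i<k. norm (mat_power A' (Suc i) *v pu (B *v u i)))"
      by (simp only: norm_minus_cancel norm_sum)
    also have "\<dots> \<le> (\<Sum>i<k. ?a (Suc i) * (b * K))"
      by (intro sum_mono order_trans[OF norm_unstable_le] mult_left_mono bK uU onorm_unstable_nonneg)
    also have "\<dots> = (\<Sum>i<k. ?a (Suc i)) * (b * K)" by (simp add: sum_distrib_right)
    also have "\<dots> \<le> (\<Sum>i. ?a (Suc i)) * (b * K)"
      using bK[OF zero_in_U] summable_Suc_iff[of ?a] summable_unstable onorm_unstable_nonneg
      by (intro mult_right_mono sum_le_suminf) (auto simp del: mat_power.simps)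
    finally show ?thesis .
  qed
  then show ?thesis by blast
qed

lemma bounded_closure_R_Int_C:
  assumes "bounded U"
  shows "bounded (closure R \<inter> C)"
proof -
  obtain c c' where "\<And>x. x \<in> closure R \<Longrightarrow> norm (ps x) \<le> c" "\<And>x. x \<in> C \<Longrightarrow> norm (pu x) \<le> c'"
    using bounded_ps_closure_R[OF assms] bounded_pu_C[OF assms] by blast
  then have "norm x \<le> c' + c" if "x \<in> closure R \<inter> C" for x
    using that norm_triangle_ineq[of "pu x" "ps x"] by (fastforce simp: pu_plus_ps)
  then show ?thesis unfolding bounded_iff by blast
qed

end

section \<open>Invariance pressure\<close>

lemma measure_mat_power_image:
  fixes M :: "real^'d^'d"
  assumes "S \<in> lmeasurable"
  shows "(\<lambda>x. mat_power M n *v x) ` S \<in> lmeasurable"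
    and "measure lebesgue ((\<lambda>x. mat_power M n *v x) ` S) = \<bar>det M\<bar> ^ n * measure lebesgue S"
proof -
  have "det (mat_power M n) = det M ^ n" by (induction n) (simp_all add: det_mul)
  then show "(\<lambda>x. mat_power M n *v x) ` S \<in> lmeasurable"
    "measure lebesgue ((\<lambda>x. mat_power M n *v x) ` S) = \<bar>det M\<bar> ^ n * measure lebesgue S"
    using lmeasurable_linear_image[OF matrix_vector_mul_linear assms, of "mat_power M n"]
    by (simp_all add: power_abs)
qed

lemma norm_add_diff_le: "norm (a + (b - c)) \<le> norm a + (norm b + norm c)"
  by (rule order_trans[OF norm_triangle_ineq add_left_mono[OF norm_triangle_ineq4]])

lemma ln_ennreal_mono: "a \<le> b \<Longrightarrow> ln_ennreal a \<le> ln_ennreal b"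
proof (cases "a = 0 \<or> b = \<infinity>")
  case False
  assume "a \<le> b"
  then have "a \<noteq> 0" "a \<noteq> \<infinity>" "b \<noteq> 0" "b \<noteq> \<infinity>" using False by (auto simp: top_unique)
  moreover have "0 < enn2real a"
    using \<open>a \<noteq> 0\<close> \<open>a \<noteq> \<infinity>\<close> by (simp add: enn2real_positive_iff less_top zero_less_iff_neq_zero)
  moreover have "enn2real a \<le> enn2real b"
    using \<open>a \<le> b\<close> \<open>b \<noteq> \<infinity>\<close> by (intro enn2real_mono) (auto simp: less_top)
  ultimately show ?thesis by (simp add: ln_ennreal_def)
qed (auto simp: ln_ennreal_def)

lemma ln_ennreal_exp:
  "0 < c \<Longrightarrow> ln_ennreal (ennreal (c * exp (real \<tau> * L))) = ereal (ln c + real \<tau> * L)"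
  by (simp add: ln_ennreal_def ln_mult)

text \<open>The logarithm turns the factor \<open>c\<close> into an additive constant, which
  division by \<tau> removes in the limit.\<close>

lemma lim_exp_rate:
  assumes "0 < c"
  shows "(\<lambda>\<tau>. ereal (1 / real \<tau>) * ln_ennreal (ennreal (c * exp (real \<tau> * L)))) \<longlonglongrightarrow> ereal L"
proof -
  have "(\<lambda>\<tau>. ln c * inverse (real \<tau>) + L) \<longlonglongrightarrow> ln c * 0 + L"
    by (intro tendsto_intros lim_inverse_n)
  then have "(\<lambda>\<tau>. ereal (ln c * inverse (real \<tau>) + L)) \<longlonglongrightarrow> ereal L" by simp
  moreover have "\<forall>\<^sub>F \<tau> in sequentially. ereal (ln c * inverse (real \<tau>) + L)
      = ereal (1 / real \<tau>) * ln_ennreal (ennreal (c * exp (real \<tau> * L)))"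
    using eventually_gt_at_top[of 0]
    by eventually_elim (simp only: ln_ennreal_exp[OF assms], simp add: field_simps)
  ultimately show ?thesis by (rule Lim_transform_eventually)
qed

lemma limsup_exp_rate_lower:
  assumes "0 < c" "\<And>\<tau>. \<tau> \<ge> 1 \<Longrightarrow> ennreal (c * exp (real \<tau> * L)) \<le> a \<tau>"
  shows "ereal L \<le> limsup (\<lambda>\<tau>. ereal (1 / real \<tau>) * ln_ennreal (a \<tau>))"
proof -
  have "ereal L = limsup (\<lambda>\<tau>. ereal (1 / real \<tau>) * ln_ennreal (ennreal (c * exp (real \<tau> * L))))"
    by (intro lim_imp_Limsup[symmetric] lim_exp_rate assms) simp
  also have "\<dots> \<le> limsup (\<lambda>\<tau>. ereal (1 / real \<tau>) * ln_ennreal (a \<tau>))"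
    by (intro Limsup_mono eventually_sequentiallyI[of 1] ereal_mult_left_mono ln_ennreal_mono assms) auto
  finally show ?thesis .
qed

lemma limsup_exp_rate_upper:
  assumes "0 < c" "\<And>\<tau>. \<tau> \<ge> 1 \<Longrightarrow> a \<tau> \<le> ennreal (c * exp (real \<tau> * L))"
  shows "limsup (\<lambda>\<tau>. ereal (1 / real \<tau>) * ln_ennreal (a \<tau>)) \<le> ereal L"
proof -
  have "limsup (\<lambda>\<tau>. ereal (1 / real \<tau>) * ln_ennreal (a \<tau>))
      \<le> limsup (\<lambda>\<tau>. ereal (1 / real \<tau>) * ln_ennreal (ennreal (c * exp (real \<tau> * L))))"
    by (intro Limsup_mono eventually_sequentiallyI[of 1] ereal_mult_left_mono ln_ennreal_mono assms) auto
  also have "\<dots> = ereal L"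
    by (intro lim_imp_Limsup lim_exp_rate assms) simp
  finally show ?thesis .
qed

lemma sum_le_infsum_ennreal:
  fixes g :: "'a \<Rightarrow> ennreal"
  assumes "finite F" "F \<subseteq> S"
  shows "sum g F \<le> infsum g S"
  unfolding infsum_finite[OF assms(1), symmetric]
  by (rule infsum_mono_neutral) (use assms in \<open>auto intro: nonneg_summable_on_complete\<close>)

section \<open>Volume estimates and the two bounds for the pressure\<close>

context hyperbolic_control_system
begin

lemma unstable_bound: "\<exists>c>0. \<forall>k x. norm (mat_power A' k *v pu x) \<le> c * norm x"
proof -
  let ?a = "\<lambda>k. onorm (\<lambda>x. mat_power A' k *v pu x)"
  have "?a k \<le> suminf ?a + 1" for k
    using sum_le_suminf[OF summable_unstable, of "{k}"] onorm_unstable_nonneg by simp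
  then have "norm (mat_power A' k *v pu x) \<le> (suminf ?a + 1) * norm x" for k x
    using norm_unstable_le[of k x] by (meson mult_right_mono norm_ge_zero order_trans)
  moreover have "0 < suminf ?a + 1"
    using suminf_nonneg[OF summable_unstable onorm_unstable_nonneg] by simp
  ultimately show ?thesis by blast
qed

text \<open>The inverse of \<open>T\<close> contracts \<open>Eu\<close> asymptotically and fixes
  \<open>Es\<close>, so all its powers share one bound.\<close>

lemma T'_bound: "\<exists>c>0. \<forall>k x. norm (mat_power T' k *v x) \<le> c * norm x"
proof -
  obtain c where c: "c > 0" "\<And>k x. norm (mat_power A' k *v pu x) \<le> c * norm x"
    using unstable_bound by blast
  have "norm (mat_power T' k *v x) \<le> (2 * c + 1) * norm x" for k x
  proof -
    \<comment> \<open>The stable part is written with exponent 0, so that the same constant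
      \<open>c\<close> also bounds \<open>pu x\<close>.\<close>
    have "mat_power T' k *v x = mat_power A' k *v pu x + (x - mat_power A' 0 *v pu x)"
      by (simp add: mat_power_T' ps_def)
    then have "norm (mat_power T' k *v x)
        \<le> norm (mat_power A' k *v pu x) + (norm x + norm (mat_power A' 0 *v pu x))"
      by (simp only: norm_add_diff_le)
    also have "\<dots> \<le> c * norm x + (norm x + c * norm x)" by (intro add_mono c order_refl)
    finally show ?thesis by (simp add: algebra_simps)
  qed
  then show ?thesis using c(1) by (intro exI[of _ "2 * c + 1"]) simp
qed

lemma det_T': "\<bar>det T'\<bar> = inverse \<bar>det T\<bar>"
proof -
  have "det T' * det T = 1" using T'T by (metis det_I det_mul)
  then show ?thesis using det_T_nonzero by (metis abs_inverse inverse_unique mult.commute)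
qed

text \<open>Initial values kept in \<open>D\<close> by one control \<open>u\<close> up to time
  \<tau> lie in a set \<open>Q u\<close> of volume \<open>V / \<bar>det T\<bar> ^ \<tau>\<close>,
  and these sets must cover a fixed ball in \<open>K\<close>. The finite subset \<open>F\<close>
  covers the case of infinite spanning sets.\<close>

lemma spanning_card_lower:
  assumes "bounded D" "K \<subseteq> D" "interior K \<noteq> {}"
  shows "\<exists>c>0. \<forall>\<tau>\<ge>1. \<forall>S. is_spanning A B U \<tau> K D S \<longrightarrow>
    (\<exists>F\<subseteq>S. finite F \<and> c * \<bar>det T\<bar> ^ \<tau> \<le> real (card F))"
proof -
  obtain b where b: "\<And>x. x \<in> D \<Longrightarrow> norm x \<le> b" using assms(1) by (auto simp: bounded_iff)
  obtain C1 where C1: "C1 > 0" "\<And>x. norm (pu x) \<le> C1 * norm x"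
    using unstable_bound by (metis mat_power.simps(1) matrix_vector_mul_lid)
  obtain p r where r: "r > 0" "ball p r \<subseteq> K" using assms(3) mem_interior by blast
  then have "p \<in> D" using assms(2) by (metis centre_in_ball subsetD)
  then have b0: "0 \<le> b" using b[of p] norm_ge_zero[of p] by linarith
  \<comment> \<open>The unstable part of the final state contributes \<open>C1 * b\<close>, the
    stable part of the initial value \<open>b + C1 * b\<close>; the 1 makes the radius
    positive.\<close>
  define \<rho> where "\<rho> = 2 * C1 * b + b + 1"
  have \<rho>: "0 < \<rho>" using b0 C1(1) by (simp add: \<rho>_def add_nonneg_pos)
  define V where "V = measure lebesgue (cball (0 :: real^'d) \<rho>)"
  have V: "0 < V" "\<And>z :: real^'d. measure lebesgue (cball z \<rho>) = V"
    using \<rho> content_cball_pos[OF \<rho>, of "0 :: real^'d"] content_cball[of \<rho>, where ?'a = "real^'d"]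
    by (simp_all add: V_def)
  define v where "v = measure lebesgue (ball p r)"
  have v: "0 < v" using content_ball_pos[OF r(1), of p] by (simp add: v_def)
  have dT: "0 < \<bar>det T\<bar>" using det_T_nonzero by simp
  have "\<exists>F\<subseteq>S. finite F \<and> (v / V) * \<bar>det T\<bar> ^ \<tau> \<le> real (card F)"
    if \<tau>: "\<tau> \<ge> 1" and S: "is_spanning A B U \<tau> K D S" for \<tau> S
  proof (cases "finite S")
    case False
    obtain n where n: "(v / V) * \<bar>det T\<bar> ^ \<tau> \<le> real n" using real_arch_simple by blast
    obtain F where "F \<subseteq> S" "finite F" "card F = n"
      using infinite_arbitrarily_large[OF False] by blast
    then show ?thesis using n by blast
  next
    case True
    \<comment> \<open>The centre \<open>z u\<close> compensates the effect of the inputs on the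
      unstable component at time \<tau>, which is the same for all initial values.\<close>
    define z where "z u = - pu (solution A B \<tau> 0 u)" for u
    define Q where "Q u = (\<lambda>x. mat_power T' \<tau> *v x) ` cball (z u) \<rho>" for u
    have "ball p r \<subseteq> (\<Union>u\<in>S. Q u)"
    proof
      fix x assume "x \<in> ball p r"
      then have xK: "x \<in> K" using r(2) by blast
      then obtain u where u: "u \<in> S" "solution A B \<tau> x u \<in> D"
        using S \<tau> unfolding is_spanning_def by force
      have "mat_power T \<tau> *v x = pu (mat_power A \<tau> *v x) + ps x"
        by (simp add: mat_power_T pu_mat_power)
      also have "pu (mat_power A \<tau> *v x) = pu (solution A B \<tau> x u) + z u"
        using solution_split[of A B \<tau> x u] linear_add[OF linear_pu] by (simp add: z_def)
      finally have "mat_power T \<tau> *v x - z u = pu (solution A B \<tau> x u) + (x - pu x)"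
        by (simp add: ps_def)
      then have "norm (mat_power T \<tau> *v x - z u)
          \<le> norm (pu (solution A B \<tau> x u)) + (norm x + norm (pu x))"
        by (simp only: norm_add_diff_le)
      also have "\<dots> \<le> C1 * b + (b + C1 * b)"
        using b[OF u(2)] b[of x] xK assms(2) C1
        by (intro add_mono order_trans[OF C1(2)] mult_left_mono) auto
      also have "\<dots> \<le> \<rho>" by (simp add: \<rho>_def)
      finally have "mat_power T \<tau> *v x \<in> cball (z u) \<rho>" by (simp add: dist_norm norm_minus_commute)
      moreover have "x = mat_power T' \<tau> *v (mat_power T \<tau> *v x)"
        by (simp add: mat_power_left_inverse_vec[OF T'T])
      ultimately show "x \<in> (\<Union>u\<in>S. Q u)" using u(1) unfolding Q_def by blast
    qed
    moreover have Q: "Q u \<in> lmeasurable" "measure lebesgue (Q u) = \<bar>det T'\<bar> ^ \<tau> * V" for u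
      unfolding Q_def using measure_mat_power_image[OF lmeasurable_cball] V(2) by metis+
    ultimately have "v \<le> measure lebesgue (\<Union>u\<in>S. Q u)"
      unfolding v_def using True by (intro measure_mono_fmeasurable fmeasurable.finite_UN[OF True]) auto
    also have "\<dots> \<le> (\<Sum>u\<in>S. measure lebesgue (Q u))"
      using True Q by (intro measure_UNION_le) auto
    also have "\<dots> = real (card S) * (inverse \<bar>det T\<bar> ^ \<tau> * V)" by (simp add: Q det_T')
    finally have "(v / V) * \<bar>det T\<bar> ^ \<tau> \<le> real (card S)"
      using V(1) dT by (simp add: field_simps)
    then show ?thesis using True by blast
  qed
  moreover have "0 < v / V" using v V by simp
  ultimately show ?thesis by blast
qed

text \<open>A maximal \<delta>-separated subset of \<open>K\<close>, with distances measured after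
  the \<tau>-th power of \<open>T\<close>, has the covering property. Its \<delta>/2-balls are
  disjoint, have volume \<open>v / \<bar>det T\<bar> ^ \<tau>\<close> and lie in one fixed ball,
  which bounds their number.\<close>

lemma separated_covering:
  assumes "bounded K" "\<delta> > 0"
  shows "\<exists>c>0. \<forall>\<tau>. \<exists>P\<subseteq>K. finite P \<and> real (card P) \<le> c * \<bar>det T\<bar> ^ \<tau> \<and>
    (\<forall>x\<in>K. \<exists>p\<in>P. norm (mat_power T \<tau> *v (x - p)) < \<delta>)"
proof -
  obtain b where b: "\<And>x. x \<in> K \<Longrightarrow> norm x \<le> b" using assms(1) by (auto simp: bounded_iff)
  obtain C1 where C1: "C1 > 0" "\<And>k x. norm (mat_power T' k *v x) \<le> C1 * norm x"
    using T'_bound by blast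
  \<comment> \<open>The summand \<open>C1 * \<delta>\<close> bounds the preimages of small balls
    uniformly in \<tau>. The absolute value is taken because \<open>b\<close> may be negative when
    \<open>K\<close> is empty.\<close>
  define \<rho> where "\<rho> = \<bar>b\<bar> + C1 * \<delta> + 1"
  have \<rho>: "0 < \<rho>" using C1(1) assms(2) by (simp add: \<rho>_def add_nonneg_pos)
  define V where "V = measure lebesgue (ball (0 :: real^'d) \<rho>)"
  define v where "v = measure lebesgue (ball (0 :: real^'d) (\<delta> / 2))"
  have V: "0 < V" using content_ball_pos[OF \<rho>, of "0 :: real^'d"] by (simp add: V_def)
  have v: "0 < v" "\<And>z :: real^'d. measure lebesgue (ball z (\<delta> / 2)) = v"
    using assms(2) content_ball_pos[of "\<delta> / 2" "0 :: real^'d"]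
      content_ball[of "\<delta> / 2", where ?'a = "real^'d"]
    by (simp_all add: v_def)
  have dT: "0 < \<bar>det T\<bar>" using det_T_nonzero by simp
  have "\<exists>P\<subseteq>K. finite P \<and> real (card P) \<le> (V / v) * \<bar>det T\<bar> ^ \<tau> \<and>
    (\<forall>x\<in>K. \<exists>p\<in>P. norm (mat_power T \<tau> *v (x - p)) < \<delta>)" for \<tau>
  proof -
    define sep where "sep P \<longleftrightarrow> P \<subseteq> K \<and> finite P \<and>
      (\<forall>p\<in>P. \<forall>q\<in>P. p \<noteq> q \<longrightarrow> \<delta> \<le> norm (mat_power T \<tau> *v (p - q)))" for P
    have card_le: "real (card P) \<le> (V / v) * \<bar>det T\<bar> ^ \<tau>" if P: "sep P" for P
    proof -
      define Q where "Q p = (\<lambda>x. mat_power T' \<tau> *v x) ` ball (mat_power T \<tau> *v p) (\<delta> / 2)" for p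
      have Q: "Q p \<in> lmeasurable" "measure lebesgue (Q p) = \<bar>det T'\<bar> ^ \<tau> * v" for p
        unfolding Q_def using measure_mat_power_image[OF lmeasurable_ball] v(2) by metis+
      have fin: "finite P" using P by (simp add: sep_def)
      have TT': "mat_power T \<tau> *v (mat_power T' \<tau> *v y) = y" for y
        using mat_power_left_inverse_vec[of T T'] T'T matrix_left_right_inverse by blast
      have disj: "Q p \<inter> Q q = {}" if pq: "p \<in> P" "q \<in> P" "p \<noteq> q" for p q
      proof (rule ccontr)
        assume "Q p \<inter> Q q \<noteq> {}"
        then obtain y where y: "y \<in> Q p" "y \<in> Q q" by blast
        have "dist (mat_power T \<tau> *v p') (mat_power T \<tau> *v y) < \<delta> / 2" if "y \<in> Q p'" for p'
        proof -
          obtain w where w: "w \<in> ball (mat_power T \<tau> *v p') (\<delta> / 2)" "y = mat_power T' \<tau> *v w"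
            using \<open>y \<in> Q p'\<close> unfolding Q_def by (rule imageE)
          then show ?thesis by (simp only: TT' mem_ball)
        qed
        from this[OF y(1)] this[OF y(2)]
        have "dist (mat_power T \<tau> *v p) (mat_power T \<tau> *v q) < \<delta>"
          by (rule dist_triangle_half_l)
        moreover have "\<delta> \<le> norm (mat_power T \<tau> *v (p - q))" using P pq unfolding sep_def by blast
        ultimately show False by (simp add: dist_norm matrix_vector_mult_diff_distrib)
      qed
      have "Q p \<subseteq> ball 0 \<rho>" if p: "p \<in> P" for p
      proof
        fix y assume "y \<in> Q p"
        then obtain w where w: "y = mat_power T' \<tau> *v w" "dist (mat_power T \<tau> *v p) w < \<delta> / 2"
          unfolding Q_def by auto
        have "y = p + mat_power T' \<tau> *v (w - mat_power T \<tau> *v p)"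
          by (simp add: w(1) matrix_vector_mult_diff_distrib mat_power_left_inverse_vec[OF T'T])
        then have "norm y \<le> norm p + norm (mat_power T' \<tau> *v (w - mat_power T \<tau> *v p))"
          using norm_triangle_ineq by metis
        also have "\<dots> \<le> b + C1 * norm (w - mat_power T \<tau> *v p)"
          using P p b by (intro add_mono C1) (auto simp: sep_def)
        also have "\<dots> \<le> \<bar>b\<bar> + C1 * \<delta>"
          using w(2) C1(1) assms(2) by (intro add_mono mult_left_mono) (auto simp: dist_norm norm_minus_commute)
        finally show "y \<in> ball 0 \<rho>" by (simp add: \<rho>_def)
      qed
      then have "(\<Union>p\<in>P. Q p) \<subseteq> ball 0 \<rho>" by blast
      then have "measure lebesgue (\<Union>p\<in>P. Q p) \<le> V"
        unfolding V_def using Q fin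
        by (intro measure_mono_fmeasurable lmeasurable_ball fmeasurableD fmeasurable.finite_UN[OF fin]) auto
      moreover have "measure lebesgue (\<Union>p\<in>P. Q p) = (\<Sum>p\<in>P. measure lebesgue (Q p))"
        using disj Q fin by (intro measure_negligible_finite_Union_image) (auto simp: pairwise_def)
      ultimately have "real (card P) * (inverse \<bar>det T\<bar> ^ \<tau> * v) \<le> V" by (simp add: Q det_T')
      then show ?thesis using v(1) dT by (simp add: field_simps)
    qed
    obtain N :: nat where N: "(V / v) * \<bar>det T\<bar> ^ \<tau> \<le> real N" using real_arch_simple by blast
    have "sep {}" by (simp add: sep_def)
    moreover have "\<forall>P. sep P \<longrightarrow> card P < Suc N" using card_le N by force
    \<comment> \<open>The volume bound on cardinalities ensures that a separated set with the most
      points exists; an uncovered \<open>x\<close> could be added to it.\<close>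
    ultimately obtain P where P: "sep P" "\<And>P'. sep P' \<Longrightarrow> card P' \<le> card P"
      using ex_has_greatest_nat[of sep "{}" card "Suc N"] by auto
    have "\<exists>p\<in>P. norm (mat_power T \<tau> *v (x - p)) < \<delta>" if x: "x \<in> K" for x
    proof (rule ccontr)
      assume "\<not> ?thesis"
      then have far: "\<And>p. p \<in> P \<Longrightarrow> \<delta> \<le> norm (mat_power T \<tau> *v (x - p))" by force
      then have "x \<notin> P" using assms(2) by force
      have "norm (mat_power T \<tau> *v (p - x)) = norm (mat_power T \<tau> *v (x - p))" for p
        by (simp add: matrix_vector_mult_diff_distrib norm_minus_commute)
      then have "sep (insert x P)" using P(1) far x unfolding sep_def by auto
      then have "card (insert x P) \<le> card P" by (rule P(2))
      then show False using \<open>x \<notin> P\<close> P(1) by (simp add: sep_def)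
    qed
    then show ?thesis using P(1) card_le[OF P(1)] unfolding sep_def by blast
  qed
  moreover have "0 < V / v" using v V by simp
  ultimately show ?thesis by blast
qed

text \<open>A spanning set contains at least \<open>c * \<bar>det T\<bar> ^ \<tau>\<close> controls,
  and each has weight at least \<open>exp (real \<tau> * m)\<close>.\<close>

lemma pressure_lower:
  assumes "bounded D" "K \<subseteq> D" "interior K \<noteq> {}" and m: "\<And>v. v \<in> U \<Longrightarrow> m \<le> f v"
  shows "ereal (ln \<bar>det T\<bar> + m) \<le> invariance_pressure A B U f K D"
proof -
  obtain c where c: "c > 0" "\<And>\<tau> S. \<tau> \<ge> 1 \<Longrightarrow> is_spanning A B U \<tau> K D S \<Longrightarrow>
    \<exists>F\<subseteq>S. finite F \<and> c * \<bar>det T\<bar> ^ \<tau> \<le> real (card F)"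
    using spanning_card_lower[OF assms(1-3)] by blast
  have dT: "0 < \<bar>det T\<bar>" using det_T_nonzero by simp
  have "ennreal (c * exp (real \<tau> * (ln \<bar>det T\<bar> + m))) \<le> pressure_sum A B U \<tau> f K D"
    if \<tau>: "\<tau> \<ge> 1" for \<tau>
    unfolding pressure_sum_def
  proof (rule INF_greatest)
    fix S assume "S \<in> {S. is_spanning A B U \<tau> K D S}"
    then have S: "is_spanning A B U \<tau> K D S" by simp
    obtain F where F: "F \<subseteq> S" "finite F" "c * \<bar>det T\<bar> ^ \<tau> \<le> real (card F)" using c(2)[OF \<tau> S] by blast
    have bs: "real \<tau> * m \<le> birkhoff_sum \<tau> f u" if "u \<in> F" for u
    proof -
      have "u \<in> control_seqs U" using that F(1) S unfolding is_spanning_def by blast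
      then have "(\<Sum>i<\<tau>. m) \<le> (\<Sum>i<\<tau>. f (u i))" by (intro sum_mono m) (simp add: control_seqs_def)
      then show ?thesis by (simp add: birkhoff_sum_def)
    qed
    have "c * exp (real \<tau> * (ln \<bar>det T\<bar> + m)) = (c * \<bar>det T\<bar> ^ \<tau>) * exp (real \<tau> * m)"
      using dT by (simp add: distrib_left exp_add exp_of_nat_mult)
    also have "\<dots> \<le> real (card F) * exp (real \<tau> * m)" using F(3) by (intro mult_right_mono) auto
    also have "\<dots> = (\<Sum>u\<in>F. exp (real \<tau> * m))" by simp
    also have "\<dots> \<le> (\<Sum>u\<in>F. exp (birkhoff_sum \<tau> f u))" using bs by (intro sum_mono) simp
    finally have "ennreal (c * exp (real \<tau> * (ln \<bar>det T\<bar> + m))) \<le> ennreal (\<Sum>u\<in>F. exp (birkhoff_sum \<tau> f u))"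
      by (rule ennreal_leI)
    also have "\<dots> = (\<Sum>u\<in>F. ennreal (exp (birkhoff_sum \<tau> f u)))" by (simp add: sum_ennreal)
    also have "\<dots> \<le> (\<Sum>\<^sub>\<infinity>u\<in>S. ennreal (exp (birkhoff_sum \<tau> f u)))"
      by (rule sum_le_infsum_ennreal[OF F(2,1)])
    finally show "ennreal (c * exp (real \<tau> * (ln \<bar>det T\<bar> + m)))
      \<le> (\<Sum>\<^sub>\<infinity>u\<in>S. ennreal (exp (birkhoff_sum \<tau> f u)))" .
  qed
  then show ?thesis unfolding invariance_pressure_def by (rule limsup_exp_rate_lower[OF c(1)])
qed

text \<open>Only the unstable component of an error has to be controlled: \<open>closure R\<close> is invariant under
  every control, and \<open>C\<close> is invariant under translations by stable vectors.\<close>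

lemma pressure_upper_at_equilibrium:
  assumes D: "D = closure R \<inter> C" and K: "compact K" "K \<subseteq> D"
    and x0: "x0 \<in> R" "x0 \<in> C" "A *v x0 + B *v u0 = x0" "u0 \<in> U"
    and M: "\<And>v. v \<in> U \<Longrightarrow> \<bar>f v\<bar> \<le> M"
  shows "invariance_pressure A B U f K D \<le> ereal (ln \<bar>det T\<bar> + f u0)"
proof -
  have "K \<subseteq> C" using K D by blast
  then obtain \<eta> N where \<eta>: "\<eta> > 0" "\<And>x. x \<in> K \<Longrightarrow> \<exists>u\<in>control_seqs U.
      (\<forall>k. ball (solution A B k x u) \<eta> \<subseteq> C) \<and> (\<forall>i\<ge>N. u i = u0)"
    using steer_to_equilibrium[OF K(1) _ x0] by blast
  then obtain g where g: "\<And>x. x \<in> K \<Longrightarrow> g x \<in> control_seqs U"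
      "\<And>x k. x \<in> K \<Longrightarrow> ball (solution A B k x (g x)) \<eta> \<subseteq> C" "\<And>x i. x \<in> K \<Longrightarrow> i \<ge> N \<Longrightarrow> g x i = u0"
    by metis
  obtain C1 where C1: "C1 > 0" "\<And>k x. norm (mat_power A' k *v pu x) \<le> C1 * norm x"
    using unstable_bound by blast
  \<comment> \<open>Pulling a deviation back from time \<tau> enlarges it at most by the factor
    \<open>C1\<close>, so \<delta> at the final time gives \<eta> at all earlier times.\<close>
  define \<delta> where "\<delta> = \<eta> / C1"
  have \<delta>: "\<delta> > 0" using C1 \<eta>(1) by (simp add: \<delta>_def)
  obtain c where c: "c > 0" "\<And>\<tau>. \<exists>P\<subseteq>K. finite P \<and> real (card P) \<le> c * \<bar>det T\<bar> ^ \<tau> \<and>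
      (\<forall>x\<in>K. \<exists>p\<in>P. norm (mat_power T \<tau> *v (x - p)) < \<delta>)"
    using separated_covering[OF compact_imp_bounded[OF K(1)] \<delta>] by blast
  have dT: "0 < \<bar>det T\<bar>" using det_T_nonzero by simp
  have M0: "0 \<le> M" using M[OF x0(4)] by simp
  \<comment> \<open>\<open>E\<close> absorbs the transient: in the first \<open>N\<close> steps the
    value of \<open>f\<close> exceeds \<open>f u0\<close> by at most \<open>2 * M\<close>, and
    afterwards the control equals \<open>u0\<close>.\<close>
  define E where "E = exp (real N * (2 * M))"
  have bs: "birkhoff_sum \<tau> f (g x) \<le> real N * (2 * M) + real \<tau> * f u0" if x: "x \<in> K" for x \<tau>
  proof -
    have "f (g x i) \<le> f u0 + (if i < N then 2 * M else 0)" for i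
      using M[of "g x i"] M[OF x0(4)] g(1)[OF x] g(3)[OF x, of i] by (auto simp: control_seqs_def abs_le_iff)
    then have "birkhoff_sum \<tau> f (g x) \<le> (\<Sum>i<\<tau>. f u0 + (if i < N then 2 * M else 0))"
      unfolding birkhoff_sum_def by (intro sum_mono)
    also have "\<dots> = real \<tau> * f u0 + (\<Sum>i<\<tau>. if i < N then 2 * M else 0)" by (simp add: sum.distrib)
    also have "(\<Sum>i<\<tau>. if i < N then 2 * M else 0) = (\<Sum>i\<in>{..<\<tau>} \<inter> {..<N}. 2 * M)"
      by (simp add: sum.If_cases lessThan_def)
    also have "\<dots> \<le> (\<Sum>i<N. 2 * M)" using M0 by (intro sum_mono2) auto
    finally show ?thesis by simp
  qed
  have "pressure_sum A B U \<tau> f K D \<le> ennreal ((c * E) * exp (real \<tau> * (ln \<bar>det T\<bar> + f u0)))" for \<tau>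
  proof -
    obtain P where P: "P \<subseteq> K" "finite P" "real (card P) \<le> c * \<bar>det T\<bar> ^ \<tau>"
        "\<And>x. x \<in> K \<Longrightarrow> \<exists>p\<in>P. norm (mat_power T \<tau> *v (x - p)) < \<delta>" using c(2)[of \<tau>] by blast
    have "is_spanning A B U \<tau> K D (g ` P)"
      unfolding is_spanning_def
    proof (intro conjI ballI)
      show "g ` P \<subseteq> control_seqs U" using g(1) P(1) by blast
      fix x assume x: "x \<in> K"
      then obtain p where p: "p \<in> P" "norm (mat_power T \<tau> *v (x - p)) < \<delta>" using P(4) by blast
      then have pK: "p \<in> K" using P(1) by blast
      have "solution A B k x (g p) \<in> D" if k: "k \<le> \<tau>" for k
      proof -
        \<comment> \<open>The unstable deviation at time \<open>k\<close> is the backward image of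
          that at time \<tau>, which the covering makes small.\<close>
        have "mat_power A k *v pu (x - p) = mat_power A' (\<tau> - k) *v (mat_power A \<tau> *v pu (x - p))"
          using mat_power_inverse_cancel[OF A'A, of "\<tau> - k" \<tau>] k by simp
        also have "mat_power A \<tau> *v pu (x - p) = pu (mat_power T \<tau> *v (x - p))"
          unfolding mat_power_T
          by (rule pu_unique[symmetric]) (auto intro: mat_power_Eu pu_in simp: ps_in)
        finally have "norm (mat_power A k *v pu (x - p)) \<le> C1 * norm (mat_power T \<tau> *v (x - p))"
          using C1(2) by simp
        also have "\<dots> < \<eta>" using p(2) C1(1) by (simp add: \<delta>_def pos_less_divide_eq mult.commute)
        finally have "solution A B k p (g p) + mat_power A k *v pu (x - p) \<in> ball (solution A B k p (g p)) \<eta>"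
          by (simp add: dist_norm)
        then have "solution A B k p (g p) + mat_power A k *v pu (x - p) \<in> C" using g(2)[OF pK] by blast
        then have "solution A B k p (g p) + mat_power A k *v pu (x - p) + mat_power A k *v ps (x - p) \<in> C"
          by (rule C_plus_Es) (intro mat_power_Es ps_in)
        moreover have "solution A B k x (g p)
            = solution A B k p (g p) + mat_power A k *v pu (x - p) + mat_power A k *v ps (x - p)"
          using solution_add[of A B k p "x - p" "g p"]
          by (simp add: add.assoc pu_plus_ps flip: matrix_vector_right_distrib)
        moreover have "solution A B k x (g p) \<in> closure R"
          using solution_in_closure_R[OF g(1)[OF pK]] x K(2) D by blast
        ultimately show ?thesis using D by simp
      qed
      then show "\<exists>u\<in>g ` P. \<forall>k\<in>{1..\<tau>}. solution A B k x u \<in> D"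
        using p(1) by (intro bexI[of _ "g p"]) auto
    qed
    then have "pressure_sum A B U \<tau> f K D \<le> (\<Sum>\<^sub>\<infinity>u\<in>g ` P. ennreal (exp (birkhoff_sum \<tau> f u)))"
      unfolding pressure_sum_def by (intro INF_lower) simp
    also have "\<dots> = ennreal (\<Sum>u\<in>g ` P. exp (birkhoff_sum \<tau> f u))"
      using P(2) by (simp add: sum_ennreal)
    also have "\<dots> \<le> ennreal ((c * E) * exp (real \<tau> * (ln \<bar>det T\<bar> + f u0)))"
    proof (rule ennreal_leI)
      have "(\<Sum>u\<in>g ` P. exp (birkhoff_sum \<tau> f u))
          \<le> real (card (g ` P)) * exp (real N * (2 * M) + real \<tau> * f u0)"
        using bs P(1) by (intro sum_bounded_above) auto
      also have "\<dots> \<le> (c * \<bar>det T\<bar> ^ \<tau>) * exp (real N * (2 * M) + real \<tau> * f u0)"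
        using card_image_le[OF P(2), of g] P(3) by (intro mult_right_mono) auto
      also have "\<dots> = (c * E) * exp (real \<tau> * (ln \<bar>det T\<bar> + f u0))"
        using dT by (simp add: E_def distrib_left exp_add exp_of_nat_mult)
      finally show "(\<Sum>u\<in>g ` P. exp (birkhoff_sum \<tau> f u))
          \<le> (c * E) * exp (real \<tau> * (ln \<bar>det T\<bar> + f u0))" .
    qed
    finally show ?thesis .
  qed
  moreover have "0 < c * E" using c(1) by (simp add: E_def)
  ultimately show ?thesis
    unfolding invariance_pressure_def by (intro limsup_exp_rate_upper)
qed

text \<open>The equilibrium of a minimizer \<open>us\<close> of \<open>f\<close> may lie on the
  boundary of \<open>R\<close> or \<open>C\<close>. The upper bound is therefore applied to
  \<open>(1 - s) us\<close> and its equilibrium, and continuity of \<open>f\<close> gives the value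
  at \<open>us\<close> as \<open>s\<close> tends to 0.\<close>

lemma pressure_eq:
  assumes U: "compact U" and D: "is_control_set A B U D" "interior D \<noteq> {}"
    and K: "compact K" "K \<subseteq> D" "interior K \<noteq> {}" and f: "continuous_on U f"
  shows "invariance_pressure A B U f K D = ereal (ln \<bar>det_unstable A\<bar> + (LEAST y. y \<in> f ` U))"
proof -
  obtain us where us: "us \<in> U" "\<And>v. v \<in> U \<Longrightarrow> f us \<le> f v"
    using continuous_attains_inf[OF U _ f] zero_in_U by blast
  then have least: "(LEAST y. y \<in> f ` U) = f us"
    by (intro Least_equality) auto
  have Deq: "D = closure R \<inter> C" using control_set_eq[OF D] .
  have "bounded D" unfolding Deq using U by (intro bounded_closure_R_Int_C compact_imp_bounded)
  then have lower: "ereal (ln \<bar>det T\<bar> + f us) \<le> invariance_pressure A B U f K D"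
    using K us(2) by (intro pressure_lower)
  obtain M where M: "\<And>v. v \<in> U \<Longrightarrow> \<bar>f v\<bar> \<le> M"
    using compact_imp_bounded[OF compact_continuous_image[OF f U]] by (auto simp: bounded_iff)
  obtain xs where xs: "A *v xs + B *v us = xs" using equilibrium_exists by blast
  have shrunk: "(1 - s) *\<^sub>R us \<in> U" if "0 \<le> s" "s \<le> 1" for s
    using convexD[OF convU us(1) zero_in_U, of "1 - s" s] that by simp
  have upper: "invariance_pressure A B U f K D \<le> ereal (ln \<bar>det T\<bar> + f ((1 - s) *\<^sub>R us))"
    if s: "0 < s" "s \<le> 1" for s
  proof (rule pressure_upper_at_equilibrium[OF Deq K(1,2) _ _ _ _ M])
    show "(1 - s) *\<^sub>R xs \<in> R" "(1 - s) *\<^sub>R xs \<in> C" using shrunk_equilibrium[OF xs us(1) s] by auto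
    show "A *v ((1 - s) *\<^sub>R xs) + B *v ((1 - s) *\<^sub>R us) = (1 - s) *\<^sub>R xs"
      using xs by (metis matrix_vector_mult_scaleR scaleR_add_right)
    show "(1 - s) *\<^sub>R us \<in> U" using shrunk s by simp
  qed
  have "continuous_on {0..1} (\<lambda>s. f ((1 - s) *\<^sub>R us))"
    by (rule continuous_on_compose2[OF f]) (use shrunk in \<open>auto intro!: continuous_intros\<close>)
  then have "((\<lambda>s. f ((1 - s) *\<^sub>R us)) \<longlongrightarrow> f ((1 - 0) *\<^sub>R us)) (at 0 within {0..1})"
    unfolding continuous_on_def by force
  then have "((\<lambda>s. ereal (ln \<bar>det T\<bar> + f ((1 - s) *\<^sub>R us))) \<longlongrightarrow> ereal (ln \<bar>det T\<bar> + f us)) (at_right 0)"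
    by (auto simp: at_within_Icc_at_right intro!: tendsto_intros)
  moreover have "\<forall>\<^sub>F s in at_right (0::real). invariance_pressure A B U f K D
      \<le> ereal (ln \<bar>det T\<bar> + f ((1 - s) *\<^sub>R us))"
    using eventually_at_right_real[of 0 1] by (auto elim!: eventually_mono intro: upper)
  ultimately have "invariance_pressure A B U f K D \<le> ereal (ln \<bar>det T\<bar> + f us)"
    by (intro tendsto_lowerbound) auto
  then show ?thesis using lower by (simp add: least det_unstable_eq antisym)
qed

end

theorem theorem32:
  fixes A :: "real^'d^'d" and B :: "real^'m^'d"
    and U :: "(real^'m) set" and D :: "(real^'d) set"
  assumes "invertible A"
    and "compact U" and "convex U" and "0 \<in> interior U" and "U = closure (interior U)"
    and "rank (kalman_matrix A B) = CARD('d)"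
    and "hyperbolic_matrix A"
    and "is_control_set A B U D" and "interior D \<noteq> {}"
  shows "bounded D \<and>
    (\<forall>K f. compact K \<and> K \<subseteq> D \<and> interior K \<noteq> {} \<and> continuous_on U f \<longrightarrow>
       invariance_pressure A B U f K D
         = ereal (ln \<bar>det_unstable A\<bar> + (LEAST y. y \<in> f ` U)) \<and>
       invariance_pressure A B U f K D
         = invariance_entropy A B U K D + ereal (LEAST y. y \<in> f ` U))"
proof -
  interpret hyperbolic_control_system A B U
    using assms by unfold_locales auto
  have "bounded D"
    unfolding control_set_eq[OF assms(8,9)]
    using assms(2) by (intro bounded_closure_R_Int_C compact_imp_bounded)
  moreover have "invariance_pressure A B U f K D
         = ereal (ln \<bar>det_unstable A\<bar> + (LEAST y. y \<in> f ` U)) \<and>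
       invariance_pressure A B U f K D
         = invariance_entropy A B U K D + ereal (LEAST y. y \<in> f ` U)"
    if "compact K" "K \<subseteq> D" "interior K \<noteq> {}" "continuous_on U f" for K f
  proof -
    \<comment> \<open>The pressure formula for the zero function then gives the entropy as the
      logarithm of the unstable determinant.\<close>
    have "(LEAST y::real. y \<in> (\<lambda>_. 0) ` U) = 0"
      using zero_in_U by (intro Least_equality) auto
    then have "invariance_entropy A B U K D = ereal (ln \<bar>det_unstable A\<bar>)"
      unfolding invariance_entropy_def
      using pressure_eq[OF assms(2,8,9) that(1-3) continuous_on_const[of U 0]] by simp
    then show ?thesis using pressure_eq[OF assms(2,8,9) that] by simp
  qed
  ultimately show ?thesis by blast
qed

end
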